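(* Let $H\in(\frac12,1)$ and $\beta\in[H,1)$ with $\beta<\frac{3H}{H+2}$, and let $X=\{X_t\}_{t\in[0,1]}$ be a Gaussian process in the class $\mathcal X^{(H,\beta)}$ on $[0,1]$, with natural filtration $\mathcal F=(\mathcal F_t)_{t\in[0,1]}$. Let $\xi$ be an $\mathcal F_1$-measurable random variable, and assume that there exists an $\mathcal F$-adapted process $\{z(t)\}_{t\in[0,1]}$ having Hölder continuous paths of some order $$\vartheta>\frac{2-2H}{1-\beta}\,\beta-2H$$ such that $z(1)=\xi$. Then there exists an $\mathcal F$-adapted process $\{\psi(t)\}_{t\in[0,1]}$ such that almost surely $\psi\in C[0,1)$ and $$\int_0^1\psi(s)\,\mathrm dX_s=\xi\quad\text{a.s.},$$ where the stochastic integral is understood as a limit of Riemann–Stieltjes sums.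
   Context: All random objects live on a complete probability space. Class $\mathcal X^{(H,\beta)}$ on $[0,1]$ ($H\in(0,1)$, $\beta\in[H,1)$): a centered Gaussian process $X=\{X_t\}_{t\in[0,1]}$ with $X_0=0$ such that, with $\sigma^2(s,t)=\mathbb E[(X_t-X_s)^2]$, there are constants $c,C>0$ with (1) $\sigma^2$ is $C^1$ for $s\ne t$ and its mixed derivative satisfies $|\partial_s\partial_t\sigma^2(s,t)|\le C|t-s|^{2H-2}$ for $s\neq t$; (2) $c|t-s|^{2\beta}\le\sigma^2(s,t)\le C|t-s|^{2H}$ for all $s,t\in[0,1]$. $X$ is taken with continuous sample paths (by (2) it has a modification that is Hölder continuous of every order less than $H$). *)

theory Defs
  imports "HOL-Probability.Probability"
begin

text \<open>A point mass counts as a Gaussian law (variance zero).\<close>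

definition gaussian_rv :: "'a measure \<Rightarrow> ('a \<Rightarrow> real) \<Rightarrow> bool" where
  "gaussian_rv M Y \<longleftrightarrow> Y \<in> borel_measurable M \<and>
     (\<exists>\<mu> \<sigma>. 0 \<le> \<sigma> \<and>
        (if \<sigma> = 0 then AE \<omega> in M. Y \<omega> = \<mu>
         else distributed M lborel Y (\<lambda>x. ennreal (normal_density \<mu> \<sigma> x))))"

text \<open>Processes are functions of time and outcome; only times in \<open>{0..1}\<close> matter.\<close>

definition gaussian_process :: "'a measure \<Rightarrow> (real \<Rightarrow> 'a \<Rightarrow> real) \<Rightarrow> bool" where
  "gaussian_process M X \<longleftrightarrow>
     (\<forall>I a. finite I \<and> I \<subseteq> {0..1} \<longrightarrow> gaussian_rv M (\<lambda>\<omega>. \<Sum>t\<in>I. a t * X t \<omega>))"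

definition incr_var :: "'a measure \<Rightarrow> (real \<Rightarrow> 'a \<Rightarrow> real) \<Rightarrow> real \<Rightarrow> real \<Rightarrow> real" where
  "incr_var M X s t = integral\<^sup>L M (\<lambda>\<omega>. (X t \<omega> - X s \<omega>)\<^sup>2)"

text \<open>
  \<open>d1\<close> and \<open>d2\<close> are the partial derivatives of \<open>v\<close> in its first and second argument, and
  \<open>d12\<close> is the derivative of \<open>d2\<close> in the first argument, all off the diagonal of the unit
  square; derivatives are one-sided at the boundary of the square.
\<close>

definition C1_offdiag_mixed_bound :: "(real \<Rightarrow> real \<Rightarrow> real) \<Rightarrow> real \<Rightarrow> real \<Rightarrow> bool" where
  "C1_offdiag_mixed_bound v H C \<longleftrightarrow>
     (\<exists>d1 d2 d12.
        (\<forall>s\<in>{0..1}. \<forall>t\<in>{0..1}. s \<noteq> t \<longrightarrow>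
           ((\<lambda>u. v u t) has_real_derivative d1 s t) (at s within {0..1}) \<and>
           ((\<lambda>u. v s u) has_real_derivative d2 s t) (at t within {0..1}) \<and>
           ((\<lambda>u. d2 u t) has_real_derivative d12 s t) (at s within {0..1}) \<and>
           \<bar>d12 s t\<bar> \<le> C * \<bar>t - s\<bar> powr (2 * H - 2)) \<and>
        continuous_on {(s, t). s \<in> {0..1} \<and> t \<in> {0..1} \<and> s \<noteq> t} (\<lambda>(s, t). d1 s t) \<and>
        continuous_on {(s, t). s \<in> {0..1} \<and> t \<in> {0..1} \<and> s \<noteq> t} (\<lambda>(s, t). d2 s t))"

definition class_X :: "'a measure \<Rightarrow> real \<Rightarrow> real \<Rightarrow> (real \<Rightarrow> 'a \<Rightarrow> real) \<Rightarrow> bool" where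
  "class_X M H \<beta> X \<longleftrightarrow>
     0 < H \<and> H < 1 \<and> H \<le> \<beta> \<and> \<beta> < 1 \<and>
     gaussian_process M X \<and>
     (\<forall>t\<in>{0..1}. integral\<^sup>L M (X t) = 0) \<and>
     (AE \<omega> in M. X 0 \<omega> = 0) \<and>
     (\<forall>\<omega>\<in>space M. continuous_on {0..1} (\<lambda>t. X t \<omega>)) \<and>
     (\<exists>c C. 0 < c \<and> 0 < C \<and>
        C1_offdiag_mixed_bound (incr_var M X) H C \<and>
        (\<forall>s\<in>{0..1}. \<forall>t\<in>{0..1}.
           c * \<bar>t - s\<bar> powr (2 * \<beta>) \<le> incr_var M X s t \<and>
           incr_var M X s t \<le> C * \<bar>t - s\<bar> powr (2 * H)))"

text \<open>The filtration generated by \<open>X\<close>, not augmented by null sets.\<close>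

definition natural_filtration :: "'a measure \<Rightarrow> (real \<Rightarrow> 'a \<Rightarrow> real) \<Rightarrow> real \<Rightarrow> 'a measure" where
  "natural_filtration M X t =
     sigma (space M) {X s -` A \<inter> space M | s A. s \<in> {0..t} \<and> A \<in> sets borel}"

definition adapted_process :: "(real \<Rightarrow> 'a measure) \<Rightarrow> (real \<Rightarrow> 'a \<Rightarrow> real) \<Rightarrow> bool" where
  "adapted_process F Y \<longleftrightarrow> (\<forall>t\<in>{0..1}. Y t \<in> borel_measurable (F t))"

definition hoelder_on :: "real set \<Rightarrow> real \<Rightarrow> (real \<Rightarrow> real) \<Rightarrow> bool" where
  "hoelder_on S \<theta> f \<longleftrightarrow> (\<exists>K. \<forall>s\<in>S. \<forall>t\<in>S. \<bar>f t - f s\<bar> \<le> K * \<bar>t - s\<bar> powr \<theta>)"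

definition partition_of :: "real \<Rightarrow> real \<Rightarrow> nat \<Rightarrow> (nat \<Rightarrow> real) \<Rightarrow> bool" where
  "partition_of a b n p \<longleftrightarrow> p 0 = a \<and> p n = b \<and> (\<forall>i<n. p i < p (Suc i))"

text \<open>
  The integral of \<open>f\<close> against \<open>g\<close> over \<open>[a, b]\<close> as the limit of Riemann-Stieltjes sums as
  the mesh tends to zero. The integrand is evaluated at left endpoints, as is usual for
  stochastic integrals. So \<open>f b\<close> plays no role and \<open>f\<close> may be unbounded near \<open>b\<close>, which
  arbitrary evaluation points would exclude unless \<open>g\<close> is constant near \<open>b\<close>.
\<close>

definition has_rs_integral ::
    "(real \<Rightarrow> real) \<Rightarrow> (real \<Rightarrow> real) \<Rightarrow> real \<Rightarrow> real \<Rightarrow> real \<Rightarrow> bool" where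
  "has_rs_integral f g a b J \<longleftrightarrow>
     (\<forall>\<epsilon>>0. \<exists>\<delta>>0. \<forall>n p.
        partition_of a b n p \<and> (\<forall>i<n. p (Suc i) - p i < \<delta>) \<longrightarrow>
        \<bar>(\<Sum>i<n. f (p i) * (g (p (Suc i)) - g (p i))) - J\<bar> < \<epsilon>)"

end

theory Submission
  imports Defs
begin

text \<open>
  Let \<open>t\<^sub>n = 1 - 2 ^ (- n)\<close> and \<open>\<epsilon>\<^sub>n = 2 ^ (- n * \<kappa>)\<close> with \<open>\<kappa>\<close> slightly larger than \<open>\<beta>\<close>. On \<open>[t\<^sub>n, t\<^sub>n\<^sub>+\<^sub>1]\<close>
  the integrand is a function of the increment \<open>X t - X t\<^sub>n\<close>, stopped when its modulus reaches \<open>\<epsilon>\<^sub>n\<close>, chosen such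
  that by the chain rule for Riemann-Stieltjes integrals (the paths are Hoelder of an order \<open>h > 1/2\<close>) the
  accumulated integral then equals \<open>z t\<^sub>n\<close>. Since \<open>X t\<^sub>n\<^sub>+\<^sub>1 - X t\<^sub>n\<close> is Gaussian with standard deviation at
  least of order \<open>2 ^ (- n * \<beta>)\<close>, the probability of not reaching \<open>\<epsilon>\<^sub>n\<close> is summable, so almost surely all but
  finitely many stages succeed, and the accumulated integral tends to \<open>z 1 = \<xi>\<close>. On late stages the integrand
  is a Lipschitz function of \<open>X\<close> with constant of order \<open>\<bar>z t\<^sub>n - z t\<^sub>n\<^sub>-\<^sub>1\<bar> / \<epsilon>\<^sub>n\<^sup>2\<close>, that is
  \<open>2 ^ (n * (2 * \<kappa> - \<theta>))\<close>. Hence the error of the Riemann sums on stage \<open>n\<close> is at most of order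
  \<open>2 ^ (n * (2 * \<kappa> - \<theta> - 2 * h))\<close>, which is summable for \<open>h\<close> close to \<open>H\<close>, since \<open>\<theta> > 2 * \<beta> - 2 * H\<close>.
\<close>

section \<open>A single stage\<close>

text \<open>Says that the exit of \<open>x\<close> from the ball of radius \<open>\<epsilon>\<close>
  around \<open>x a\<close> has happened by time \<open>t\<close>, without forming an exit
  time.\<close>

definition hit :: "(real \<Rightarrow> real) \<Rightarrow> real \<Rightarrow> real \<Rightarrow> real \<Rightarrow> bool" where
  "hit x \<epsilon> a t \<longleftrightarrow> (\<exists>s\<in>{a..t}. \<epsilon> \<le> \<bar>x s - x a\<bar>)"

text \<open>
  \<open>weight\<close> interpolates between the value \<open>w\<close> at \<open>0\<close> and the value \<open>0\<close> at \<open>\<plusminus>\<epsilon>\<close>, and is chosen so that its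
  primitive equals the target \<open>y\<close> at both ends: whichever end the process reaches first, the integral
  gains \<open>y\<close> and the integrand can be stopped continuously.
\<close>

definition weight :: "real \<Rightarrow> real \<Rightarrow> real \<Rightarrow> real \<Rightarrow> real" where
  "weight w y \<epsilon> u = w * ((1 - \<bar>u\<bar> / \<epsilon>) * (1 - 3 * (\<bar>u\<bar> / \<epsilon>))) + 6 * y / \<epsilon>\<^sup>2 * (u * (1 - \<bar>u\<bar> / \<epsilon>))"

definition primitive :: "real \<Rightarrow> real \<Rightarrow> real \<Rightarrow> real \<Rightarrow> real" where
  "primitive w y \<epsilon> u = w * (u * (1 - \<bar>u\<bar> / \<epsilon>)\<^sup>2) + y * ((u / \<epsilon>)\<^sup>2 * (3 - 2 * (\<bar>u\<bar> / \<epsilon>)))"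

lemma weight_0 [simp]: "weight w y \<epsilon> 0 = w"
  by (simp add: weight_def)

lemma primitive_0 [simp]: "primitive w y \<epsilon> 0 = 0"
  by (simp add: primitive_def)

lemma weight_end: "0 < \<epsilon> \<Longrightarrow> \<bar>u\<bar> = \<epsilon> \<Longrightarrow> weight w y \<epsilon> u = 0"
  by (simp add: weight_def)

lemma primitive_end: "0 < \<epsilon> \<Longrightarrow> \<bar>u\<bar> = \<epsilon> \<Longrightarrow> primitive w y \<epsilon> u = y"
  by (auto simp: primitive_def abs_if power2_eq_square split: if_splits)

text \<open>For \<open>w = 0\<close> the primitive is \<open>y\<close> times the cubic
  \<open>r\<^sup>2 * (3 - 2 * r)\<close>, which maps \<open>[0, 1]\<close> into itself. A stage that
  starts with integrand \<open>0\<close> therefore never overshoots its target.\<close>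

lemma primitive_bound:
  assumes "\<bar>u\<bar> \<le> \<epsilon>" "0 < \<epsilon>"
  shows "\<bar>primitive 0 y \<epsilon> u\<bar> \<le> \<bar>y\<bar>"
proof -
  define r where "r = \<bar>u\<bar> / \<epsilon>"
  have r: "0 \<le> r" "r \<le> 1" using assms by (auto simp: r_def)
  have "(u / \<epsilon>)\<^sup>2 = r\<^sup>2" by (simp add: r_def power_divide)
  moreover have "1 - r\<^sup>2 * (3 - 2 * r) = (1 - r)\<^sup>2 * (1 + 2 * r)"
    by (simp add: power2_eq_square algebra_simps)
  then have "r\<^sup>2 * (3 - 2 * r) \<le> 1"
    using r by (smt (verit) mult_nonneg_nonneg zero_le_power2)
  moreover have "0 \<le> r\<^sup>2 * (3 - 2 * r)" using r by simp
  ultimately have "\<bar>(u / \<epsilon>)\<^sup>2 * (3 - 2 * (\<bar>u\<bar> / \<epsilon>))\<bar> \<le> 1"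
    unfolding r_def by simp
  then show ?thesis
    unfolding primitive_def by (simp add: abs_mult mult_left_le)
qed

text \<open>A piecewise polynomial: \<open>P \<sigma>\<close> with
  \<open>\<sigma> = \<plusminus>1\<close> is the branch on each half-line, and at \<open>0\<close>
  both one-sided derivatives equal \<open>w\<close>.\<close>

lemma primitive_has_derivative:
  assumes "0 < \<epsilon>"
  shows "(primitive w y \<epsilon> has_real_derivative weight w y \<epsilon> u) (at u)"
proof -
  define P where "P = (\<lambda>\<sigma> u. w * (u * (1 - \<sigma> * u / \<epsilon>)\<^sup>2) + y * ((u / \<epsilon>)\<^sup>2 * (3 - 2 * (\<sigma> * u / \<epsilon>))))"
  define Q where "Q = (\<lambda>\<sigma> u. w * ((1 - \<sigma> * u / \<epsilon>) * (1 - 3 * (\<sigma> * u / \<epsilon>))) + 6 * y / \<epsilon>\<^sup>2 * (u * (1 - \<sigma> * u / \<epsilon>)))"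
  have der: "(P \<sigma> has_real_derivative Q \<sigma> u) (at u)" for \<sigma> u
    unfolding P_def Q_def using assms
    by (auto intro!: derivative_eq_intros simp: field_simps power2_eq_square)
  have pos: "primitive w y \<epsilon> v = P 1 v" if "0 \<le> v" for v
    using that by (simp add: primitive_def P_def)
  have neg: "primitive w y \<epsilon> v = P (-1) v" if "v \<le> 0" for v
    using that by (simp add: primitive_def P_def)
  consider "u > 0" | "u < 0" | "u = 0" by linarith
  then show ?thesis
  proof cases
    case 1
    have "(primitive w y \<epsilon> has_real_derivative Q 1 u) (at u)"
      by (rule has_field_derivative_transform_within_open[OF der, of "{0<..}"])
        (use 1 in \<open>auto simp: pos\<close>)
    moreover have "Q 1 u = weight w y \<epsilon> u" using 1 by (simp add: Q_def weight_def)
    ultimately show ?thesis by simp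
  next
    case 2
    have "(primitive w y \<epsilon> has_real_derivative Q (-1) u) (at u)"
      by (rule has_field_derivative_transform_within_open[OF der, of "{..<0}"])
        (use 2 in \<open>auto simp: neg\<close>)
    moreover have "Q (-1) u = weight w y \<epsilon> u" using 2 by (simp add: Q_def weight_def)
    ultimately show ?thesis by simp
  next
    case 3
    have Q0: "Q \<sigma> 0 = w" for \<sigma> by (simp add: Q_def)
    have R: "(primitive w y \<epsilon> has_real_derivative w) (at 0 within {0..})"
      by (rule has_field_derivative_transform_within[OF has_field_derivative_at_within[OF der[of 1 0, unfolded Q0]] zero_less_one])
        (auto simp: pos)
    have L: "(primitive w y \<epsilon> has_real_derivative w) (at 0 within {..0})"
      by (rule has_field_derivative_transform_within[OF has_field_derivative_at_within[OF der[of "-1" 0, unfolded Q0]] zero_less_one])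
        (auto simp: neg)
    have "((primitive w y \<epsilon>) has_real_derivative w) (at 0 within ({0..} \<union> {..0}))"
      using R L unfolding has_field_derivative_iff by (rule Lim_Un)
    moreover have "{0..} \<union> {..0} = (UNIV :: real set)" by auto
    ultimately show ?thesis using 3 by simp
  qed
qed

text \<open>A Lipschitz constant of \<open>weight\<close> on
  \<open>[-\<epsilon>, \<epsilon>]\<close>. With \<open>r = \<bar>u\<bar> / \<epsilon>\<close>, the
  factor \<open>4\<close> bounds the slope in \<open>r\<close> of
  \<open>(1 - r) * (1 - 3 * r)\<close>, and \<open>18 = 6 * 3\<close> with \<open>3\<close> bounding
  the slope of \<open>u * (1 - r)\<close>.\<close>

definition lip :: "real \<Rightarrow> real \<Rightarrow> real \<Rightarrow> real" where
  "lip w y \<epsilon> = 4 * \<bar>w\<bar> / \<epsilon> + 18 * \<bar>y\<bar> / \<epsilon>\<^sup>2"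

lemma lip_nonneg: "0 < \<epsilon> \<Longrightarrow> 0 \<le> lip w y \<epsilon>"
  by (simp add: lip_def)

lemma weight_lipschitz:
  assumes "0 < \<epsilon>" "\<bar>u\<bar> \<le> \<epsilon>" "\<bar>v\<bar> \<le> \<epsilon>"
  shows "\<bar>weight w y \<epsilon> u - weight w y \<epsilon> v\<bar> \<le> lip w y \<epsilon> * \<bar>u - v\<bar>"
proof -
  define r where "r = \<bar>u\<bar> / \<epsilon>"
  define s where "s = \<bar>v\<bar> / \<epsilon>"
  have r: "0 \<le> r" "r \<le> 1" "0 \<le> s" "s \<le> 1" using assms by (auto simp: r_def s_def)
  have rs: "\<bar>r - s\<bar> \<le> \<bar>u - v\<bar> / \<epsilon>"
    using assms unfolding r_def s_def
    by (metis abs_divide abs_triangle_ineq3 abs_of_pos diff_divide_distrib divide_right_mono less_imp_le)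
  have A: "\<bar>(1 - r) * (1 - 3 * r) - (1 - s) * (1 - 3 * s)\<bar> \<le> 4 * \<bar>u - v\<bar> / \<epsilon>"
  proof -
    have "(1 - r) * (1 - 3 * r) - (1 - s) * (1 - 3 * s) = (r - s) * (3 * (r + s) - 4)"
      by (simp add: algebra_simps)
    moreover have "\<bar>3 * (r + s) - 4\<bar> \<le> 4" using r by auto
    then have "\<bar>(r - s) * (3 * (r + s) - 4)\<bar> \<le> \<bar>r - s\<bar> * 4"
      by (simp add: abs_mult mult_left_mono)
    ultimately show ?thesis using rs by simp
  qed
  have B: "\<bar>u * (1 - r) - v * (1 - s)\<bar> \<le> 3 * \<bar>u - v\<bar>"
  proof -
    have "u * (1 - r) - v * (1 - s) = (u - v) * (1 - r) + v * (s - r)"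
      by (simp add: algebra_simps)
    moreover have "\<bar>(u - v) * (1 - r)\<bar> \<le> \<bar>u - v\<bar>" using r by (simp add: abs_mult mult_left_le)
    moreover have "\<bar>v * (s - r)\<bar> \<le> \<epsilon> * (\<bar>u - v\<bar> / \<epsilon>)"
      unfolding abs_mult using rs assms by (intro mult_mono) auto
    ultimately have "\<bar>u * (1 - r) - v * (1 - s)\<bar> \<le> \<bar>u - v\<bar> + \<bar>u - v\<bar>"
      using assms abs_triangle_ineq[of "(u - v) * (1 - r)" "v * (s - r)"] by simp
    also have "\<bar>u - v\<bar> + \<bar>u - v\<bar> \<le> 3 * \<bar>u - v\<bar>" by simp
    finally show ?thesis .
  qed
  have "weight w y \<epsilon> u - weight w y \<epsilon> v =
     w * ((1 - r) * (1 - 3 * r) - (1 - s) * (1 - 3 * s)) + 6 * y / \<epsilon>\<^sup>2 * (u * (1 - r) - v * (1 - s))"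
    unfolding weight_def r_def s_def by (simp only: right_diff_distrib add_diff_add)
  also have "\<bar>\<dots>\<bar> \<le> \<bar>w\<bar> * (4 * \<bar>u - v\<bar> / \<epsilon>) + \<bar>6 * y / \<epsilon>\<^sup>2\<bar> * (3 * \<bar>u - v\<bar>)"
    by (rule order_trans[OF abs_triangle_ineq], unfold abs_mult[of w] abs_mult[of "6 * y / \<epsilon>\<^sup>2"])
      (intro add_mono mult_left_mono A B abs_ge_zero)
  also have "\<dots> = lip w y \<epsilon> * \<bar>u - v\<bar>"
    by (simp add: lip_def algebra_simps abs_mult)
  finally show ?thesis .
qed

text \<open>The chain rule for one step of the Riemann sum. By the mean value theorem the increment
  of the primitive is a nearby weight times \<open>v - u\<close>, and the Lipschitz bound makes the
  left-point error quadratic.\<close>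

lemma primitive_taylor:
  assumes "0 < \<epsilon>" "\<bar>u\<bar> \<le> \<epsilon>" "\<bar>v\<bar> \<le> \<epsilon>"
  shows "\<bar>weight w y \<epsilon> u * (v - u) - (primitive w y \<epsilon> v - primitive w y \<epsilon> u)\<bar>
    \<le> lip w y \<epsilon> * (v - u)\<^sup>2"
proof -
  obtain m where m: "\<bar>m - u\<bar> \<le> \<bar>v - u\<bar>" "\<bar>m\<bar> \<le> \<epsilon>"
    "primitive w y \<epsilon> v - primitive w y \<epsilon> u = (v - u) * weight w y \<epsilon> m"
  proof (cases u v rule: linorder_cases)
    case less
    from MVT2[OF less primitive_has_derivative[OF assms(1)]]
    obtain m where "u < m" "m < v" "primitive w y \<epsilon> v - primitive w y \<epsilon> u = (v - u) * weight w y \<epsilon> m"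
      by metis
    then show ?thesis using that[of m] assms by auto
  next
    case equal
    then show ?thesis using that[of u] assms by simp
  next
    case greater
    from MVT2[OF greater primitive_has_derivative[OF assms(1)]]
    obtain m where "v < m" "m < u" "primitive w y \<epsilon> u - primitive w y \<epsilon> v = (u - v) * weight w y \<epsilon> m"
      by metis
    then show ?thesis using that[of m] assms by (auto simp: algebra_simps)
  qed
  have "weight w y \<epsilon> u * (v - u) - (primitive w y \<epsilon> v - primitive w y \<epsilon> u)
      = (weight w y \<epsilon> u - weight w y \<epsilon> m) * (v - u)"
    by (simp add: m(3) algebra_simps)
  also have "\<bar>\<dots>\<bar> \<le> lip w y \<epsilon> * \<bar>u - m\<bar> * \<bar>v - u\<bar>"
    unfolding abs_mult using weight_lipschitz[OF assms(1,2) m(2)] by (simp add: mult_right_mono)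
  also have "\<dots> \<le> lip w y \<epsilon> * \<bar>v - u\<bar> * \<bar>v - u\<bar>"
    using m(1) lip_nonneg[OF assms(1)] by (intro mult_right_mono mult_left_mono) auto
  finally show ?thesis by (simp add: power2_eq_square mult.assoc)
qed

section \<open>The integrand stopped at the exit, and its integral\<close>

definition stage_integrand :: "(real \<Rightarrow> real) \<Rightarrow> real \<Rightarrow> real \<Rightarrow> real \<Rightarrow> real \<Rightarrow> real \<Rightarrow> real" where
  "stage_integrand x w y \<epsilon> a t = (if hit x \<epsilon> a t then 0 else weight w y \<epsilon> (x t - x a))"

text \<open>The candidate for the integral of \<open>stage_integrand\<close> over
  \<open>[a, t]\<close>, confirmed by \<open>stage_error\<close>. It is frozen at \<open>y\<close>
  after the exit because \<open>primitive\<close> equals \<open>y\<close> at both exit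
  points.\<close>

definition stage_integral :: "(real \<Rightarrow> real) \<Rightarrow> real \<Rightarrow> real \<Rightarrow> real \<Rightarrow> real \<Rightarrow> real \<Rightarrow> real" where
  "stage_integral x w y \<epsilon> a t = (if hit x \<epsilon> a t then y else primitive w y \<epsilon> (x t - x a))"

lemma hit_mono: "hit x \<epsilon> a s \<Longrightarrow> s \<le> t \<Longrightarrow> hit x \<epsilon> a t"
  unfolding hit_def by force

lemma hit_start [simp]: "0 < \<epsilon> \<Longrightarrow> \<not> hit x \<epsilon> a a"
  by (simp add: hit_def)

lemma not_hit_bound: "\<not> hit x \<epsilon> a t \<Longrightarrow> s \<in> {a..t} \<Longrightarrow> \<bar>x s - x a\<bar> < \<epsilon>"
  unfolding hit_def by force

text \<open>The intermediate value theorem between \<open>p\<close> and a time that witnesses the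
  hit. Later arguments need some time at which the modulus is exactly \<open>\<epsilon>\<close>, not
  necessarily the first one.\<close>

lemma hit_time:
  assumes "continuous_on {a..q} x" "a \<le> p" "\<not> hit x \<epsilon> a p" "hit x \<epsilon> a q" "p \<le> q"
  obtains \<tau> where "p \<le> \<tau>" "\<tau> \<le> q" "\<bar>x \<tau> - x a\<bar> = \<epsilon>"
proof -
  obtain s where s: "a \<le> s" "s \<le> q" "\<epsilon> \<le> \<bar>x s - x a\<bar>"
    using assms(4) by (auto simp: hit_def)
  have "p \<le> s"
    using s not_hit_bound[OF assms(3), of s] by force
  moreover have "\<bar>x p - x a\<bar> \<le> \<epsilon>"
    using not_hit_bound[OF assms(3), of p] assms(2) by simp
  moreover have "continuous_on {p..s} (\<lambda>t. \<bar>x t - x a\<bar>)"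
    by (intro continuous_intros continuous_on_subset[OF assms(1)]) (use s assms in auto)
  ultimately obtain t where "p \<le> t" "t \<le> s" "\<bar>x t - x a\<bar> = \<epsilon>"
    using IVT'[of "\<lambda>t. \<bar>x t - x a\<bar>" p \<epsilon> s] s by auto
  then show ?thesis using that s by auto
qed

context
  fixes x :: "real \<Rightarrow> real" and w y \<epsilon> a b h K :: real
  assumes \<epsilon>: "0 < \<epsilon>" and h: "0 < h" and K: "0 \<le> K"
    and cont: "continuous_on {a..b} x"
    and hoelder: "\<And>s t. s \<in> {a..b} \<Longrightarrow> t \<in> {a..b} \<Longrightarrow> \<bar>x t - x s\<bar> \<le> K * \<bar>t - s\<bar> powr h"
begin

lemma hoelder_le:
  assumes "a \<le> p" "p \<le> s" "s \<le> t" "t \<le> q" "q \<le> b"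
  shows "\<bar>x t - x s\<bar> \<le> K * (q - p) powr h"
proof -
  have "\<bar>x t - x s\<bar> \<le> K * \<bar>t - s\<bar> powr h" using assms by (intro hoelder) auto
  also have "\<dots> \<le> K * (q - p) powr h"
    using assms K h by (intro mult_left_mono powr_mono2) auto
  finally show ?thesis .
qed

text \<open>If the exit falls between \<open>p\<close> and \<open>q\<close>, the value
  \<open>0\<close> at \<open>q\<close> is replaced by the value of \<open>weight\<close> at an exit
  point \<open>\<tau>\<close>, which is \<open>0\<close> as well.\<close>

lemma stage_integrand_hoelder:
  assumes "a \<le> p" "p \<le> q" "q \<le> b"
  shows "\<bar>stage_integrand x w y \<epsilon> a q - stage_integrand x w y \<epsilon> a p\<bar>
     \<le> lip w y \<epsilon> * K * (q - p) powr h"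
proof -
  note L = lip_nonneg[OF \<epsilon>, of w y]
  consider "hit x \<epsilon> a p" | "\<not> hit x \<epsilon> a q" | "\<not> hit x \<epsilon> a p" "hit x \<epsilon> a q" by blast
  then show ?thesis
  proof cases
    case 1
    then show ?thesis using hit_mono[OF 1 assms(2)] L K by (simp add: stage_integrand_def)
  next
    case 2
    then have np: "\<not> hit x \<epsilon> a p" using hit_mono assms(2) by blast
    have "\<bar>weight w y \<epsilon> (x q - x a) - weight w y \<epsilon> (x p - x a)\<bar> \<le> lip w y \<epsilon> * \<bar>x q - x p\<bar>"
      using weight_lipschitz[OF \<epsilon>, of "x q - x a" "x p - x a" w y]
        not_hit_bound[OF 2, of q] not_hit_bound[OF np, of p] assms by simp
    also have "\<dots> \<le> lip w y \<epsilon> * (K * (q - p) powr h)"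
      by (intro mult_left_mono hoelder_le L) (use assms in auto)
    finally show ?thesis using 2 np by (simp add: stage_integrand_def mult.assoc)
  next
    case 3
    obtain \<tau> where \<tau>: "p \<le> \<tau>" "\<tau> \<le> q" "\<bar>x \<tau> - x a\<bar> = \<epsilon>"
      using hit_time[OF continuous_on_subset[OF cont] assms(1) 3(1,2) assms(2)] assms by auto
    have "\<bar>weight w y \<epsilon> (x \<tau> - x a) - weight w y \<epsilon> (x p - x a)\<bar> \<le> lip w y \<epsilon> * \<bar>x \<tau> - x p\<bar>"
      using weight_lipschitz[OF \<epsilon>, of "x \<tau> - x a" "x p - x a" w y]
        not_hit_bound[OF 3(1), of p] \<tau>(3) assms by simp
    also have "\<dots> \<le> lip w y \<epsilon> * (K * (q - p) powr h)"
      by (intro mult_left_mono hoelder_le L) (use assms \<tau> in auto)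
    finally show ?thesis using 3 weight_end[OF \<epsilon> \<tau>(3)] by (simp add: stage_integrand_def mult.assoc)
  qed
qed

text \<open>Without an exit in between this is \<open>primitive_taylor\<close>. With an exit point
  \<open>\<tau>\<close>, the part up to \<open>\<tau>\<close> is again a Taylor error, and the rest
  multiplies \<open>x q - x \<tau>\<close> by a weight that is small because it vanishes at
  \<open>\<tau>\<close>. Each part costs one \<open>B\<close>, hence the factor
  \<open>2\<close>.\<close>

lemma stage_error:
  assumes "a \<le> p" "p \<le> q" "q \<le> b"
  shows "\<bar>stage_integrand x w y \<epsilon> a p * (x q - x p)
     - (stage_integral x w y \<epsilon> a q - stage_integral x w y \<epsilon> a p)\<bar>
     \<le> 2 * lip w y \<epsilon> * K\<^sup>2 * (q - p) powr (2 * h)"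
proof -
  note L = lip_nonneg[OF \<epsilon>, of w y]
  define B where "B = lip w y \<epsilon> * (K * (q - p) powr h)\<^sup>2"
  have B: "2 * B = 2 * lip w y \<epsilon> * K\<^sup>2 * (q - p) powr (2 * h)"
    unfolding B_def power_mult_distrib using assms
    by (simp add: power2_eq_square flip: powr_add)
  have B0: "0 \<le> B" using L by (simp add: B_def)
  have sq: "lip w y \<epsilon> * (x t - x s)\<^sup>2 \<le> B" if "p \<le> s" "s \<le> t" "t \<le> q" for s t
    unfolding B_def using hoelder_le[OF assms(1) that assms(3)] L
    by (intro mult_left_mono) (simp_all add: abs_le_square_iff[symmetric] abs_mult K)
  consider "hit x \<epsilon> a p" | "\<not> hit x \<epsilon> a q" | "\<not> hit x \<epsilon> a p" "hit x \<epsilon> a q" by blast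
  then show ?thesis
  proof cases
    case 1
    then show ?thesis using hit_mono[OF 1 assms(2)] B0 B
      by (simp add: stage_integrand_def stage_integral_def)
  next
    case 2
    then have np: "\<not> hit x \<epsilon> a p" using hit_mono assms(2) by blast
    have "\<bar>weight w y \<epsilon> (x p - x a) * (x q - x p) -
       (primitive w y \<epsilon> (x q - x a) - primitive w y \<epsilon> (x p - x a))\<bar> \<le> lip w y \<epsilon> * (x q - x p)\<^sup>2"
      using primitive_taylor[OF \<epsilon>, of "x p - x a" "x q - x a" w y]
        not_hit_bound[OF 2, of q] not_hit_bound[OF np, of p] assms by simp
    also have "\<dots> \<le> B" using assms by (intro sq) auto
    finally show ?thesis using 2 np B0 B by (simp add: stage_integrand_def stage_integral_def)
  next
    case 3
    obtain \<tau> where \<tau>: "p \<le> \<tau>" "\<tau> \<le> q" "\<bar>x \<tau> - x a\<bar> = \<epsilon>"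
      using hit_time[OF continuous_on_subset[OF cont] assms(1) 3(1,2) assms(2)] assms by auto
    have b: "\<bar>x p - x a\<bar> \<le> \<epsilon>" "\<bar>x \<tau> - x a\<bar> \<le> \<epsilon>"
      using not_hit_bound[OF 3(1), of p] \<tau> assms by auto
    have "\<bar>weight w y \<epsilon> (x p - x a) * (x \<tau> - x p) -
       (primitive w y \<epsilon> (x \<tau> - x a) - primitive w y \<epsilon> (x p - x a))\<bar> \<le> lip w y \<epsilon> * (x \<tau> - x p)\<^sup>2"
      using primitive_taylor[OF \<epsilon> b, of w y] by simp
    also have "\<dots> \<le> B" using \<tau> by (intro sq) auto
    finally have 1: "\<bar>weight w y \<epsilon> (x p - x a) * (x \<tau> - x p) -
       (y - primitive w y \<epsilon> (x p - x a))\<bar> \<le> B"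
      by (simp add: primitive_end[OF \<epsilon> \<tau>(3)])
    have "\<bar>weight w y \<epsilon> (x p - x a)\<bar> \<le> lip w y \<epsilon> * \<bar>x \<tau> - x p\<bar>"
      using weight_lipschitz[OF \<epsilon> b(2,1), of w y] weight_end[OF \<epsilon> \<tau>(3), of w y] by simp
    also have "\<dots> \<le> lip w y \<epsilon> * (K * (q - p) powr h)"
      by (intro mult_left_mono hoelder_le L) (use assms \<tau> in auto)
    finally have "\<bar>weight w y \<epsilon> (x p - x a) * (x q - x \<tau>)\<bar> \<le>
       lip w y \<epsilon> * (K * (q - p) powr h) * (K * (q - p) powr h)"
      unfolding abs_mult using assms \<tau> L K by (intro mult_mono hoelder_le) auto
    then have 2: "\<bar>weight w y \<epsilon> (x p - x a) * (x q - x \<tau>)\<bar> \<le> B"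
      by (simp add: B_def power2_eq_square algebra_simps)
    have "weight w y \<epsilon> (x p - x a) * (x q - x p) =
      weight w y \<epsilon> (x p - x a) * (x \<tau> - x p) + weight w y \<epsilon> (x p - x a) * (x q - x \<tau>)"
      by (simp add: algebra_simps)
    then have "\<bar>weight w y \<epsilon> (x p - x a) * (x q - x p) - (y - primitive w y \<epsilon> (x p - x a))\<bar> \<le> 2 * B"
      using 1 2 by linarith
    then show ?thesis using 3 B by (simp add: stage_integrand_def stage_integral_def)
  qed
qed

end

section \<open>Riemann-Stieltjes sums on a geometric grid\<close>

lemma partition_of_bounds:
  assumes "partition_of a b n p" "i \<le> n"
  shows "a \<le> p i" "p i \<le> b"
proof -
  have s: "p j \<le> p (Suc j)" if "j < n" for j
    using assms(1) that by (auto simp: partition_of_def intro: less_imp_le)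
  have "p 0 \<le> p i"
    using assms(2) by (induction i) (auto intro: order_trans[OF _ s])
  then show "a \<le> p i" using assms(1) by (simp add: partition_of_def)
  have "p i \<le> p n"
    using assms(2) by (induction rule: inc_induct) (auto intro: order_trans[OF s])
  then show "p i \<le> b" using assms(1) by (simp add: partition_of_def)
qed

text \<open>Young's argument: since \<open>\<eta> > 1\<close>, the errors add up to at most
  \<open>C\<close> times the total increment of \<open>\<Phi>\<close> times the largest increment to
  the power \<open>\<eta> - 1\<close>, which is small for small mesh by uniform continuity.\<close>

lemma has_rs_integral_control:
  fixes \<Phi> :: "real \<Rightarrow> real"
  assumes cont: "continuous_on {a..b} \<Phi>"
    and mono: "mono_on {a..b} \<Phi>" and \<eta>: "1 < \<eta>" and C: "0 \<le> C"
    and bound: "\<And>p q. a \<le> p \<Longrightarrow> p \<le> q \<Longrightarrow> q \<le> b \<Longrightarrow>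
       \<bar>f p * (g q - g p) - (V q - V p)\<bar> \<le> C * (\<Phi> q - \<Phi> p) powr \<eta>"
  shows "has_rs_integral f g a b (V b - V a)"
  unfolding has_rs_integral_def
proof (intro allI impI)
  fix \<epsilon> :: real
  assume \<epsilon>: "0 < \<epsilon>"
  show "\<exists>\<delta>>0. \<forall>n p. partition_of a b n p \<and> (\<forall>i<n. p (Suc i) - p i < \<delta>) \<longrightarrow>
        \<bar>(\<Sum>i<n. f (p i) * (g (p (Suc i)) - g (p i))) - (V b - V a)\<bar> < \<epsilon>"
  proof (cases "a \<le> b")
    case False
    then have "\<not> partition_of a b n p" for n p
      using partition_of_bounds[of a b n p n] partition_of_bounds[of a b n p 0] by auto
    then show ?thesis by (intro exI[of _ 1]) auto
  next
    case True
    define T where "T = \<Phi> b - \<Phi> a"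
    have T: "0 \<le> T" using monotone_onD[OF mono, of a b] True by (simp add: T_def)
    \<comment> \<open>Chosen such that \<open>C * T * m powr (\<eta> - 1) < \<epsilon>\<close>. The
      added \<open>1\<close> keeps the denominator positive and the inequality strict.\<close>
    define m where "m = (\<epsilon> / (C * T + 1)) powr (1 / (\<eta> - 1))"
    have CT: "0 < C * T + 1" using C T by (smt (verit) mult_nonneg_nonneg)
    have m: "0 < m" "m powr (\<eta> - 1) = \<epsilon> / (C * T + 1)"
      using \<epsilon> CT \<eta> by (auto simp: m_def powr_powr)
    have "uniformly_continuous_on {a..b} \<Phi>"
      by (rule compact_uniformly_continuous[OF cont]) simp
    then obtain \<delta> where \<delta>: "0 < \<delta>"
      "\<And>s t. s \<in> {a..b} \<Longrightarrow> t \<in> {a..b} \<Longrightarrow> dist t s < \<delta> \<Longrightarrow> dist (\<Phi> t) (\<Phi> s) < m"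
      unfolding uniformly_continuous_on_def using m(1) by blast
    show ?thesis
    proof (intro exI[of _ \<delta>] conjI allI impI \<delta>(1))
      fix n p
      assume "partition_of a b n p \<and> (\<forall>i<n. p (Suc i) - p i < \<delta>)"
      then have P: "partition_of a b n p" and mesh: "\<And>i. i < n \<Longrightarrow> p (Suc i) - p i < \<delta>" by auto
      have inc: "p i < p (Suc i)" if "i < n" for i using P that by (simp add: partition_of_def)
      note pb = partition_of_bounds[OF P]
      have tele: "(\<Sum>i<n. F (p (Suc i)) - F (p i)) = F b - F a" for F :: "real \<Rightarrow> real"
        using P by (simp add: sum_lessThan_telescope[of "\<lambda>i. F (p i)"] partition_of_def)
      have "(\<Sum>i<n. f (p i) * (g (p (Suc i)) - g (p i))) - (V b - V a) =
          (\<Sum>i<n. f (p i) * (g (p (Suc i)) - g (p i)) - (V (p (Suc i)) - V (p i)))"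
        by (simp add: sum_subtractf[of _ "\<lambda>i. V (p (Suc i)) - V (p i)"] tele)
      also have "\<bar>\<dots>\<bar> \<le> (\<Sum>i<n. C * m powr (\<eta> - 1) * (\<Phi> (p (Suc i)) - \<Phi> (p i)))"
      proof (rule order_trans[OF sum_abs sum_mono])
        fix i assume "i \<in> {..<n}"
        then have i: "i < n" by simp
        define \<gamma> where "\<gamma> = \<Phi> (p (Suc i)) - \<Phi> (p i)"
        have \<gamma>: "0 \<le> \<gamma>" using monotone_onD[OF mono, of "p i" "p (Suc i)"] inc[OF i] pb[of i] pb[of "Suc i"] i
          by (simp add: \<gamma>_def)
        have "dist (p (Suc i)) (p i) < \<delta>" using mesh[OF i] inc[OF i] by (simp add: dist_real_def)
        then have "\<gamma> < m"
          using \<delta>(2)[of "p i" "p (Suc i)"] pb[of i] pb[of "Suc i"] i by (auto simp: \<gamma>_def dist_real_def)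
        then have "\<gamma> powr (\<eta> - 1) * \<gamma> \<le> m powr (\<eta> - 1) * \<gamma>"
          using \<gamma> \<eta> by (intro mult_right_mono powr_mono2) auto
        moreover have "\<gamma> powr \<eta> = \<gamma> powr (\<eta> - 1) * \<gamma>"
          using \<gamma> by (cases "\<gamma> = 0") (auto simp: powr_mult_base powr_diff)
        ultimately have "C * \<gamma> powr \<eta> \<le> C * (m powr (\<eta> - 1) * \<gamma>)"
          using C by (simp add: mult_left_mono)
        then show "\<bar>f (p i) * (g (p (Suc i)) - g (p i)) - (V (p (Suc i)) - V (p i))\<bar>
           \<le> C * m powr (\<eta> - 1) * (\<Phi> (p (Suc i)) - \<Phi> (p i))"
          using bound[of "p i" "p (Suc i)"] inc[OF i] pb[of i] pb[of "Suc i"] i by (simp add: \<gamma>_def)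
      qed
      also have "\<dots> = C * m powr (\<eta> - 1) * T"
        by (simp add: tele T_def flip: sum_distrib_left)
      also have "\<dots> = \<epsilon> * ((C * T) / (C * T + 1))" by (simp add: m(2))
      also have "\<dots> < \<epsilon> * 1"
        using \<epsilon> CT by (intro mult_strict_left_mono) (auto simp: divide_less_eq)
      finally show "\<bar>(\<Sum>i<n. f (p i) * (g (p (Suc i)) - g (p i))) - (V b - V a)\<bar> < \<epsilon>" by simp
    qed
  qed
qed

text \<open>Concavity of the power: the increment is at least \<open>r - s\<close> times the slope
  at the right end \<open>r\<close>, which is at least the slope at \<open>d\<close>. The tangent
  inequality is Young's inequality divided by \<open>r powr (1 - \<rho>)\<close>.\<close>

lemma powr_gap:
  fixes r s d \<rho> :: real
  assumes "0 \<le> s" "s \<le> r" "r \<le> d" "0 < \<rho>" "\<rho> < 1"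
  shows "\<rho> * d powr (\<rho> - 1) * (r - s) \<le> r powr \<rho> - s powr \<rho>"
proof (cases "r = 0")
  case True
  then show ?thesis using assms by simp
next
  case False
  then have r: "0 < r" using assms by simp
  have "s powr \<rho> * r powr (1 - \<rho>) \<le> \<rho> * s + (1 - \<rho>) * r"
  proof (cases "s = 0")
    case False
    then show ?thesis using Youngs_inequality_0[of \<rho> "1 - \<rho>" s r] assms r by simp
  qed (use assms r in simp)
  then have "s powr \<rho> * r powr (1 - \<rho>) * r powr (\<rho> - 1) \<le> (\<rho> * s + (1 - \<rho>) * r) * r powr (\<rho> - 1)"
    by (rule mult_right_mono) simp
  moreover have "s powr \<rho> * r powr (1 - \<rho>) * r powr (\<rho> - 1) = s powr \<rho>"
    using r by (simp add: mult.assoc flip: powr_add)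
  moreover have "(\<rho> * s + (1 - \<rho>) * r) * r powr (\<rho> - 1) = r powr \<rho> - \<rho> * r powr (\<rho> - 1) * (r - s)"
  proof -
    have "(\<rho> * s + (1 - \<rho>) * r) * c = r * c - \<rho> * c * (r - s)" for c
      by (simp add: algebra_simps)
    moreover have "r * r powr (\<rho> - 1) = r powr \<rho>" using r by (simp add: powr_mult_base)
    ultimately show ?thesis by simp
  qed
  moreover have "\<rho> * d powr (\<rho> - 1) * (r - s) \<le> \<rho> * r powr (\<rho> - 1) * (r - s)"
    using assms r by (intro mult_right_mono mult_left_mono powr_mono2') auto
  ultimately show ?thesis by linarith
qed

section \<open>The dyadic grid accumulating at \<open>1\<close>\<close>

definition grid :: "nat \<Rightarrow> real" where
  "grid n = 1 - (1 / 2) ^ n"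

lemma grid_0 [simp]: "grid 0 = 0"
  by (simp add: grid_def)

lemma grid_less_1: "grid n < 1"
  by (simp add: grid_def)

lemma grid_nonneg: "0 \<le> grid n"
  by (simp add: grid_def power_le_one)

lemma grid_Suc_diff: "grid (Suc n) - grid n = (1 / 2) ^ n / 2"
  by (simp add: grid_def)

lemma grid_mono: "m \<le> n \<Longrightarrow> grid m \<le> grid n"
  by (simp add: grid_def power_decreasing)

lemma grid_less_Suc: "grid n < grid (Suc n)"
  by (simp add: grid_def)

lemma grid_interval:
  assumes "0 \<le> t" "t < 1"
  obtains n where "grid n \<le> t" "t < grid (Suc n)"
proof -
  obtain k where "(1 / 2) ^ k < 1 - t"
    using real_arch_pow_inv[of "1 - t" "1 / 2"] assms by auto
  then have "t < grid k" by (simp add: grid_def)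
  then obtain n where "\<forall>i<n. \<not> t < grid (Suc i)" "t < grid (Suc n)"
    using ex_least_nat_le[of "\<lambda>n. t < grid (Suc n)" k] grid_less_Suc[of k]
    by (metis order_less_trans)
  moreover from this have "grid n \<le> t" using assms by (cases n) auto
  ultimately show ?thesis using that by blast
qed

text \<open>
  The superadditive control is a power of the increments of \<open>\<Phi> t = - (1 - t) powr \<rho>\<close>, whose slope on
  stage \<open>n\<close> is at least of order \<open>2 ^ (n * (1 - \<rho>))\<close> and so absorbs the constants growing with \<open>n\<close>. The
  finitely many stages before \<open>M\<close> only enlarge the constant.
\<close>

lemma has_rs_integral_grid:
  assumes h: "1 / 2 < h" and \<rho>: "0 < \<rho>" "\<rho> < 1" and K: "0 \<le> K" and \<Lambda>: "0 \<le> \<Lambda>"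
    and hoelder: "\<And>s t. s \<in> {0..1} \<Longrightarrow> t \<in> {0..1} \<Longrightarrow> \<bar>x t - x s\<bar> \<le> K * \<bar>t - s\<bar> powr h"
    and local_error: "\<And>n p q. grid n \<le> p \<Longrightarrow> p \<le> q \<Longrightarrow> q \<le> grid (Suc n) \<Longrightarrow>
       \<bar>\<psi> p * (x q - x p) - (V q - V p)\<bar> \<le> \<Lambda> * ((1 / 2) ^ n) powr (- (2 * h * (1 - \<rho>))) * (q - p) powr (2 * h)"
    and local_hoelder: "\<And>n p q. grid n \<le> p \<Longrightarrow> p \<le> q \<Longrightarrow> q \<le> grid (Suc n) \<Longrightarrow>
       \<bar>\<psi> q - \<psi> p\<bar> \<le> \<Lambda> * ((1 / 2) ^ n) powr (- (2 * h * (1 - \<rho>))) * (q - p) powr h"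
    and tail: "\<And>m q. M \<le> m \<Longrightarrow> grid (Suc m) \<le> q \<Longrightarrow> q \<le> 1 \<Longrightarrow>
       \<bar>\<psi> (grid m) * (x q - x (grid m)) - (V q - V (grid m))\<bar> \<le> \<Lambda> * ((1 / 2) ^ m) powr (2 * h * \<rho>)"
  shows "has_rs_integral \<psi> x 0 1 (V 1 - V 0)"
proof -
  \<comment> \<open>The error of a one-term Riemann sum. The aim is a bound by a multiple of
    \<open>G p q\<close> for all \<open>p \<le> q\<close>, as \<open>has_rs_integral_control\<close>
    demands.\<close>
  define e where "e = (\<lambda>p q. \<psi> p * (x q - x p) - (V q - V p))"
  define \<Phi> where "\<Phi> = (\<lambda>t::real. - ((1 - t) powr \<rho>))"
  define G where "G = (\<lambda>p q. (\<Phi> q - \<Phi> p) powr (2 * h))"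
  define c where "c = (1 / \<rho>) powr (2 * h)"
  have c: "0 \<le> c" by (simp add: c_def)
  have mono: "\<Phi> s \<le> \<Phi> t" if "s \<le> t" "t \<le> 1" for s t
    using that \<rho> by (simp add: \<Phi>_def powr_mono2)
  have G_mono: "G s t \<le> G p q" if "p \<le> s" "s \<le> t" "t \<le> q" "q \<le> 1" for p s t q
    unfolding G_def using mono[of p s] mono[of s t] mono[of t q] that h
    by (intro powr_mono2) auto
  \<comment> \<open>The error is not additive: cutting at \<open>s\<close> leaves a cross term,
    since the second piece is then evaluated at \<open>s\<close> instead of
    \<open>p\<close>.\<close>
  have split: "e p q = e p s + e s q + (\<psi> p - \<psi> s) * (x q - x s)" for p s q
    by (simp add: e_def algebra_simps)
  \<comment> \<open>This is \<open>powr_gap\<close> for \<open>1 - q \<le> 1 - p \<le> d\<close>,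
    raised to the power \<open>2 * h\<close>. The point \<open>q\<close> may lie in any later
    stage.\<close>
  have key: "((1 / 2) ^ n) powr (- (2 * h * (1 - \<rho>))) * (q - p) powr (2 * h) \<le> c * G p q"
    if "grid n \<le> p" "p \<le> q" "q \<le> 1" for n p q
  proof -
    define d where "d = (1 / 2 :: real) ^ n"
    have d: "0 < d" by (simp add: d_def)
    have "\<rho> * d powr (\<rho> - 1) * ((1 - p) - (1 - q)) \<le> (1 - p) powr \<rho> - (1 - q) powr \<rho>"
      by (rule powr_gap) (use that \<rho> in \<open>auto simp: grid_def d_def\<close>)
    then have "d powr (\<rho> - 1) * (q - p) \<le> (1 / \<rho>) * (\<Phi> q - \<Phi> p)"
      using \<rho> by (simp add: \<Phi>_def field_simps)
    then have "(d powr (\<rho> - 1) * (q - p)) powr (2 * h) \<le> ((1 / \<rho>) * (\<Phi> q - \<Phi> p)) powr (2 * h)"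
      using h that by (intro powr_mono2) auto
    moreover have "(d powr (\<rho> - 1) * (q - p)) powr (2 * h) = d powr (- (2 * h * (1 - \<rho>))) * (q - p) powr (2 * h)"
      unfolding powr_mult powr_powr by (simp add: algebra_simps)
    moreover have "((1 / \<rho>) * (\<Phi> q - \<Phi> p)) powr (2 * h) = c * G p q"
      using \<rho> mono[of p q] that by (simp only: powr_mult c_def G_def)
    ultimately show ?thesis by (simp add: d_def)
  qed
  have e1: "\<bar>e p q\<bar> \<le> \<Lambda> * c * G p q" if "grid n \<le> p" "p \<le> q" "q \<le> grid (Suc n)" for n p q
  proof -
    have "\<bar>e p q\<bar> \<le> \<Lambda> * (((1 / 2) ^ n) powr (- (2 * h * (1 - \<rho>))) * (q - p) powr (2 * h))"
      using local_error[OF that] by (simp add: e_def mult.assoc)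
    also have "\<dots> \<le> \<Lambda> * (c * G p q)"
      using that grid_less_1[of "Suc n"] by (intro mult_left_mono key \<Lambda>) auto
    finally show ?thesis by (simp add: mult.assoc)
  qed
  \<comment> \<open>Here \<open>p\<close> and \<open>s\<close> share a stage, so
    \<open>local_hoelder\<close> applies to \<open>\<psi>\<close>, while \<open>q\<close> may lie
    beyond it and the global bound on \<open>x\<close> is used on \<open>[s, q]\<close>.\<close>
  have e2: "\<bar>(\<psi> p - \<psi> s) * (x q - x s)\<bar> \<le> \<Lambda> * K * c * G p q"
    if "grid n \<le> p" "p \<le> s" "s \<le> grid (Suc n)" "s \<le> q" "q \<le> 1" for n p s q
  proof -
    define D where "D = ((1 / 2) ^ n) powr (- (2 * h * (1 - \<rho>)))"
    have s01: "0 \<le> s" using that grid_nonneg[of n] by simp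
    have D: "0 \<le> D" by (simp add: D_def)
    have "\<bar>\<psi> p - \<psi> s\<bar> \<le> \<Lambda> * D * (s - p) powr h"
      using local_hoelder[OF that(1-3)] by (simp add: D_def abs_minus_commute)
    also have "\<dots> \<le> \<Lambda> * D * (q - p) powr h"
      using that h \<Lambda> by (intro mult_left_mono powr_mono2) (auto simp: D_def)
    finally have 1: "\<bar>\<psi> p - \<psi> s\<bar> \<le> \<Lambda> * D * (q - p) powr h" .
    have "\<bar>x q - x s\<bar> \<le> K * \<bar>q - s\<bar> powr h"
      using that s01 by (intro hoelder) auto
    also have "\<dots> \<le> K * (q - p) powr h"
      using that h K by (intro mult_left_mono powr_mono2) auto
    finally have 2: "\<bar>x q - x s\<bar> \<le> K * (q - p) powr h" .
    have "\<bar>(\<psi> p - \<psi> s) * (x q - x s)\<bar> \<le> (\<Lambda> * D * (q - p) powr h) * (K * (q - p) powr h)"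
      unfolding abs_mult using 1 2 \<Lambda> D by (intro mult_mono) auto
    also have "\<dots> = \<Lambda> * K * (D * (q - p) powr (2 * h))"
      using powr_add[of "q - p" h h] by simp
    also have "\<dots> \<le> \<Lambda> * K * (c * G p q)"
      unfolding D_def using that by (intro mult_left_mono key) (auto simp: \<Lambda> K)
    finally show ?thesis by (simp add: mult.assoc)
  qed
  have G0: "0 \<le> G p q" for p q by (simp add: G_def)
  have "\<exists>C\<ge>0. \<forall>m\<ge>0. \<forall>q. grid m \<le> q \<and> q \<le> 1 \<longrightarrow> \<bar>e (grid m) q\<bar> \<le> C * G (grid m) q"
    using le0[of M]
  proof (induction rule: inc_induct)
    case base
    define C where "C = \<Lambda> * c + \<Lambda> * 2 powr (2 * h) * c"
    have "\<bar>e (grid m) q\<bar> \<le> C * G (grid m) q" if "M \<le> m" "grid m \<le> q" "q \<le> 1" for m q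
    proof (cases "q \<le> grid (Suc m)")
      case True
      then have "\<bar>e (grid m) q\<bar> \<le> \<Lambda> * c * G (grid m) q" using e1[of m "grid m" q] that by simp
      also have "\<dots> \<le> C * G (grid m) q"
        using \<Lambda> c G0 by (intro mult_right_mono) (auto simp: C_def)
      finally show ?thesis .
    next
      case False
      define d where "d = (1 / 2 :: real) ^ m"
      have d: "0 < d" by (simp add: d_def)
      \<comment> \<open>For \<open>q\<close> past stage \<open>m\<close>, the bound from
        \<open>tail\<close> is compared with the control of the full stage. Its length
        \<open>d / 2\<close> produces the factor \<open>2 powr (2 * h)\<close>.\<close>
      have "d powr (2 * h * \<rho>) = 2 powr (2 * h) * (d powr (- (2 * h * (1 - \<rho>))) * (d / 2) powr (2 * h))"
      proof -
        have "2 * h * \<rho> = - (2 * h * (1 - \<rho>)) + 2 * h" by (simp add: algebra_simps)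
        then have "d powr (2 * h * \<rho>) = d powr (- (2 * h * (1 - \<rho>))) * d powr (2 * h)"
          by (simp only: powr_add)
        then show ?thesis using d by (simp add: powr_divide)
      qed
      also have "\<dots> \<le> 2 powr (2 * h) * (c * G (grid m) (grid (Suc m)))"
        using key[of m "grid m" "grid (Suc m)"] grid_less_Suc[of m] grid_less_1[of "Suc m"]
        by (intro mult_left_mono) (auto simp: d_def grid_Suc_diff)
      also have "\<dots> \<le> 2 powr (2 * h) * (c * G (grid m) q)"
        using False that grid_less_Suc[of m] by (intro mult_left_mono G_mono c) auto
      finally have "\<Lambda> * d powr (2 * h * \<rho>) \<le> \<Lambda> * (2 powr (2 * h) * (c * G (grid m) q))"
        using \<Lambda> by (rule mult_left_mono)
      moreover have "\<bar>e (grid m) q\<bar> \<le> \<Lambda> * d powr (2 * h * \<rho>)"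
        using tail[of m q] that False by (simp add: e_def d_def)
      ultimately have "\<bar>e (grid m) q\<bar> \<le> (\<Lambda> * 2 powr (2 * h) * c) * G (grid m) q"
        by (simp add: mult.assoc)
      also have "\<dots> \<le> C * G (grid m) q"
        using \<Lambda> c G0 by (intro mult_right_mono) (auto simp: C_def)
      finally show ?thesis .
    qed
    moreover have "0 \<le> C" using \<Lambda> c by (simp add: C_def)
    ultimately show ?case by blast
  next
    case (step n)
    then obtain C where C: "0 \<le> C"
      "\<And>m q. Suc n \<le> m \<Longrightarrow> grid m \<le> q \<Longrightarrow> q \<le> 1 \<Longrightarrow> \<bar>e (grid m) q\<bar> \<le> C * G (grid m) q" by blast
    define C' where "C' = \<Lambda> * c + C + \<Lambda> * K * c"
    have C': "0 \<le> C'" "C \<le> C'" "\<Lambda> * c \<le> C'" using C(1) \<Lambda> c K by (auto simp: C'_def)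
    have "\<bar>e (grid m) q\<bar> \<le> C' * G (grid m) q" if "n \<le> m" "grid m \<le> q" "q \<le> 1" for m q
    proof -
      consider "Suc n \<le> m" | "m = n" "q \<le> grid (Suc n)" | "m = n" "grid (Suc n) \<le> q"
        using \<open>n \<le> m\<close> \<open>grid m \<le> q\<close> by (metis le_antisym linear not_less_eq_eq)
      then show ?thesis
      proof cases
        case 1
        then have "\<bar>e (grid m) q\<bar> \<le> C * G (grid m) q" using C(2) that by simp
        also have "\<dots> \<le> C' * G (grid m) q" using C' G0 by (intro mult_right_mono) auto
        finally show ?thesis .
      next
        case 2
        then have "\<bar>e (grid m) q\<bar> \<le> \<Lambda> * c * G (grid m) q" using e1[of n "grid n" q] that by simp
        also have "\<dots> \<le> C' * G (grid m) q" using C' G0 by (intro mult_right_mono) auto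
        finally show ?thesis .
      next
        case 3
        let ?s = "grid (Suc n)"
        have s: "grid n \<le> ?s" using grid_less_Suc[of n] by simp
        have "\<bar>e (grid n) ?s\<bar> \<le> \<Lambda> * c * G (grid n) ?s" using e1[of n "grid n" ?s] s by simp
        also have "\<dots> \<le> \<Lambda> * c * G (grid n) q"
          using G_mono[of "grid n" "grid n" ?s q] s 3 that \<Lambda> c by (intro mult_left_mono) auto
        finally have 1: "\<bar>e (grid n) ?s\<bar> \<le> \<Lambda> * c * G (grid n) q" .
        have "\<bar>e ?s q\<bar> \<le> C * G ?s q" using C(2)[of "Suc n" q] 3 that by simp
        also have "\<dots> \<le> C * G (grid n) q"
          using G_mono[of "grid n" ?s q q] s 3 that C(1) by (intro mult_left_mono) auto
        finally have 2: "\<bar>e ?s q\<bar> \<le> C * G (grid n) q" .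
        show ?thesis
          using 1 2 e2[of n "grid n" ?s q] split[of "grid n" q ?s] s 3 that
          by (simp add: C'_def algebra_simps)
      qed
    qed
    then show ?case using C'(1) by blast
  qed
  then obtain C where C: "0 \<le> C"
      "\<And>m q. grid m \<le> q \<Longrightarrow> q \<le> 1 \<Longrightarrow> \<bar>e (grid m) q\<bar> \<le> C * G (grid m) q" by blast
  define C' where "C' = \<Lambda> * c + C + \<Lambda> * K * c"
  have C': "0 \<le> C'" "\<Lambda> * c \<le> C'" using C(1) \<Lambda> c K by (auto simp: C'_def)
  have main: "\<bar>e p q\<bar> \<le> C' * G p q" if "0 \<le> p" "p \<le> q" "q \<le> 1" for p q
  proof (cases "p = 1")
    case True
    then show ?thesis using that C' G0 by (simp add: e_def)
  next
    case False
    then obtain n where n: "grid n \<le> p" "p < grid (Suc n)" using grid_interval[of p] \<open>0 \<le> p\<close> \<open>p \<le> q\<close> \<open>q \<le> 1\<close> by auto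
    let ?s = "grid (Suc n)"
    show ?thesis
    proof (cases "q \<le> ?s")
      case True
      then have "\<bar>e p q\<bar> \<le> \<Lambda> * c * G p q" using e1[of n p q] that n by simp
      also have "\<dots> \<le> C' * G p q" using C' G0 by (intro mult_right_mono) auto
      finally show ?thesis .
    next
      case False
      have "\<bar>e p ?s\<bar> \<le> \<Lambda> * c * G p ?s" using e1[of n p ?s] n by simp
      also have "\<dots> \<le> \<Lambda> * c * G p q"
        using G_mono[of p p ?s q] n False that \<Lambda> c by (intro mult_left_mono) auto
      finally have 1: "\<bar>e p ?s\<bar> \<le> \<Lambda> * c * G p q" .
      have "\<bar>e ?s q\<bar> \<le> C * G ?s q" using C(2)[of "Suc n" q] False that by simp
      also have "\<dots> \<le> C * G p q"
        using G_mono[of p ?s q q] n False that C(1) by (intro mult_left_mono) auto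
      finally have 2: "\<bar>e ?s q\<bar> \<le> C * G p q" .
      show ?thesis
        using 1 2 e2[of n p ?s q] split[of p q ?s] n False that
        by (simp add: C'_def algebra_simps)
    qed
  qed
  show ?thesis
  proof (rule has_rs_integral_control)
    show "continuous_on {0..1} \<Phi>"
      unfolding \<Phi>_def using \<rho> by (intro continuous_on_minus continuous_on_powr' continuous_intros) auto
    show "mono_on {0..1} \<Phi>" using mono by (auto simp: monotone_on_def)
    show "1 < 2 * h" using h by simp
    show "0 \<le> C'" by fact
    show "\<bar>\<psi> p * (x q - x p) - (V q - V p)\<bar> \<le> C' * (\<Phi> q - \<Phi> p) powr (2 * h)"
      if "0 \<le> p" "p \<le> q" "q \<le> 1" for p q
      using main[OF that] by (simp add: e_def G_def)
  qed
qed

section \<open>Hoelder continuity of paths\<close>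

text \<open>Chaining: \<open>D n t\<close> is the largest dyadic point of level \<open>n\<close> not
  exceeding \<open>t\<close>. Refining the level moves it by at most one cell of the finer grid, so
  its error is a geometric tail, and two times at distance about \<open>2 ^ (- n)\<close> have equal
  or adjacent approximations of level \<open>n\<close>.\<close>

lemma hoelder_of_dyadic:
  fixes f :: "real \<Rightarrow> real"
  assumes cont: "continuous_on {0..1} f" and h: "0 < h" and A: "0 \<le> A"
    and step: "\<And>n i. i < 2 ^ n \<Longrightarrow> \<bar>f (real (Suc i) / 2 ^ n) - f (real i / 2 ^ n)\<bar> \<le> A * ((1 / 2) ^ n) powr h"
  shows "\<exists>K\<ge>0. \<forall>s\<in>{0..1}. \<forall>t\<in>{0..1}. \<bar>f t - f s\<bar> \<le> K * \<bar>t - s\<bar> powr h"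
proof -
  define q where "q = (1 / 2 :: real) powr h"
  have "q < (1 / 2) powr 0" unfolding q_def by (rule powr_less_mono') (use h in auto)
  then have q: "0 < q" "q < 1" by (auto simp: q_def)
  have qn: "((1 / 2) ^ n) powr h = q ^ n" for n
    by (simp add: q_def powr_powr powr_realpow[symmetric] mult.commute)
  define j where "j = (\<lambda>n (t::real). nat \<lfloor>t * 2 ^ n\<rfloor>)"
  define D where "D = (\<lambda>n t. real (j n t) / 2 ^ n)"
  \<comment> \<open>The sum of the series \<open>A * q ^ n\<close>. In the form
    \<open>A = B * (1 - q)\<close> it turns the sums in \<open>chain\<close> into telescoping
    differences.\<close>
  define B where "B = A / (1 - q)"
  have B: "0 \<le> B" "A = B * (1 - q)" using A q by (auto simp: B_def)
  have j_le: "j n t \<le> 2 ^ n" if "t \<in> {0..1}" for n t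
  proof -
    have "t * 2 ^ n \<le> 2 ^ n" using that by (simp add: mult_le_cancel_right1)
    then have "\<lfloor>t * 2 ^ n\<rfloor> \<le> \<lfloor>2 ^ n :: real\<rfloor>" by (rule floor_mono)
    then show ?thesis by (simp add: j_def nat_le_iff)
  qed
  have j_floor: "real (j n t) \<le> t * 2 ^ n" "t * 2 ^ n < real (j n t) + 1" if "t \<in> {0..1}" for n t
    using that by (auto simp: j_def)
  have D01: "D n t \<in> {0..1}" if "t \<in> {0..1}" for n t
    using j_le[OF that, of n] by (simp add: D_def divide_le_eq flip: of_nat_le_iff)
  have adj: "\<bar>f (real k / 2 ^ n) - f (real i / 2 ^ n)\<bar> \<le> A * q ^ n"
    if "k = i \<or> k = Suc i" "k \<le> 2 ^ n" for n i k
    using that step[of i n] A q by (auto simp: qn)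
  have refine: "\<bar>f (D (Suc n) t) - f (D n t)\<bar> \<le> A * q ^ Suc n" if t: "t \<in> {0..1}" for n t
  proof -
    have "real (2 * j n t) < real (j (Suc n) t) + 1" "real (j (Suc n) t) < real (2 * j n t) + 2"
      using j_floor[OF t, of n] j_floor[OF t, of "Suc n"] by auto
    then have "2 * j n t < j (Suc n) t + 1" "j (Suc n) t < 2 * j n t + 2"
      by linarith+
    then have "j (Suc n) t = 2 * j n t \<or> j (Suc n) t = Suc (2 * j n t)" by linarith
    moreover have "D n t = real (2 * j n t) / 2 ^ Suc n" by (simp add: D_def)
    ultimately show ?thesis using adj[of "j (Suc n) t" "2 * j n t" "Suc n"] j_le[OF t, of "Suc n"]
      by (simp only: D_def)
  qed
  have chain: "\<bar>f (D (n + k) t) - f (D n t)\<bar> \<le> B * (q ^ n - q ^ (n + k))" if t: "t \<in> {0..1}" for n k t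
  proof (induction k)
    case (Suc k)
    have "A * q ^ Suc (n + k) \<le> A * q ^ (n + k)"
      using A q by (intro mult_left_mono power_decreasing) auto
    also have "\<dots> = B * (q ^ (n + k) - q ^ Suc (n + k))" by (simp add: B(2) algebra_simps)
    finally have "\<bar>f (D (Suc (n + k)) t) - f (D (n + k) t)\<bar> \<le> B * (q ^ (n + k) - q ^ Suc (n + k))"
      using refine[OF t, of "n + k"] by linarith
    then show ?case using Suc by (simp add: right_diff_distrib)
  qed simp
  have lim: "(\<lambda>k. D k t) \<longlonglongrightarrow> t" if t: "t \<in> {0..1}" for t
  proof (rule tendsto_sandwich[of "\<lambda>k. t - (1 / 2) ^ k" _ _ "\<lambda>k. t"])
    show "\<forall>\<^sub>F k in sequentially. t - (1 / 2) ^ k \<le> D k t"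
    proof (intro always_eventually allI)
      fix k
      have "t \<le> (real (j k t) + 1) / 2 ^ k"
        using j_floor(2)[OF t, of k] by (simp add: le_divide_eq)
      then show "t - (1 / 2) ^ k \<le> D k t" by (simp add: D_def add_divide_distrib power_one_over)
    qed
    show "\<forall>\<^sub>F k in sequentially. D k t \<le> t"
      using j_floor[OF t] by (intro always_eventually allI) (simp add: D_def field_simps)
    have "(\<lambda>k. t - (1 / 2) ^ k) \<longlonglongrightarrow> t - 0"
      by (intro tendsto_intros LIMSEQ_power_zero) auto
    then show "(\<lambda>k. t - (1 / 2) ^ k) \<longlonglongrightarrow> t" by simp
  qed auto
  have approx: "\<bar>f t - f (D n t)\<bar> \<le> B * q ^ n" if t: "t \<in> {0..1}" for n t
  proof (rule LIMSEQ_le_const2)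
    have "(\<lambda>k. f (D (k + n) t)) \<longlonglongrightarrow> f t"
      by (rule continuous_on_tendsto_compose[OF cont LIMSEQ_ignore_initial_segment[OF lim[OF t]] t])
        (use D01[OF t] in auto)
    then show "(\<lambda>k. \<bar>f (D (k + n) t) - f (D n t)\<bar>) \<longlonglongrightarrow> \<bar>f t - f (D n t)\<bar>"
      by (intro tendsto_intros)
    have "B * (q ^ n - q ^ (n + k)) \<le> B * q ^ n" for k
      using B(1) q by (intro mult_left_mono) auto
    then show "\<exists>N. \<forall>k\<ge>N. \<bar>f (D (k + n) t) - f (D n t)\<bar> \<le> B * q ^ n"
      using chain[OF t, of n] by (metis add.commute order_trans)
  qed
  define K where "K = (2 * B + A) * 2 powr h"
  have K: "0 \<le> K" using A B by (simp add: K_def)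
  have main: "\<bar>f t - f s\<bar> \<le> K * (t - s) powr h" if "s \<in> {0..1}" "t \<in> {0..1}" "s < t" for s t
  proof -
    \<comment> \<open>Applied to \<open>1 - (t - s)\<close>, \<open>grid_interval\<close> selects
      the dyadic scale of \<open>t - s\<close>, exact up to a factor \<open>2\<close>.\<close>
    obtain n where "grid n \<le> 1 - (t - s)" "1 - (t - s) < grid (Suc n)"
      using grid_interval[of "1 - (t - s)"] \<open>s \<in> {0..1}\<close> \<open>t \<in> {0..1}\<close> \<open>s < t\<close> by auto
    then have n: "t - s \<le> (1 / 2) ^ n" "(1 / 2) ^ n \<le> 2 * (t - s)" by (auto simp: grid_def)
    have "t * 2 ^ n \<le> s * 2 ^ n + 1" using n(1) by (simp add: field_simps)
    then have "real (j n t) < real (j n s) + 2"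
      using j_floor[OF that(1), of n] j_floor[OF that(2), of n] by linarith
    moreover have "s * 2 ^ n \<le> t * 2 ^ n" using that by simp
    then have "real (j n s) < real (j n t) + 1"
      using j_floor[OF that(1), of n] j_floor[OF that(2), of n] by linarith
    ultimately have "j n t = j n s \<or> j n t = Suc (j n s)" by linarith
    then have "\<bar>f (D n t) - f (D n s)\<bar> \<le> A * q ^ n"
      using adj[of "j n t" "j n s" n] j_le[OF that(2), of n] by (simp only: D_def)
    then have "\<bar>f t - f s\<bar> \<le> B * q ^ n + B * q ^ n + A * q ^ n"
      using approx[OF that(1), of n] approx[OF that(2), of n] by linarith
    also have "\<dots> = (2 * B + A) * ((1 / 2) ^ n) powr h" by (simp add: qn algebra_simps)
    also have "\<dots> \<le> (2 * B + A) * (2 * (t - s)) powr h"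
      using A B h n by (intro mult_left_mono powr_mono2) auto
    also have "\<dots> = K * (t - s) powr h" by (simp only: K_def powr_mult mult.assoc)
    finally show ?thesis .
  qed
  show ?thesis
  proof (intro exI[of _ K] conjI ballI K)
    fix s t :: real assume "s \<in> {0..1}" "t \<in> {0..1}"
    then show "\<bar>f t - f s\<bar> \<le> K * \<bar>t - s\<bar> powr h"
      using main[of s t] main[of t s] by (cases s t rule: linorder_cases) (auto simp: abs_minus_commute)
  qed
qed

text \<open>Kolmogorov's criterion. By Markov's inequality the probability that one of the
  \<open>2 ^ n\<close> increments of level \<open>n\<close> reaches \<open>d n powr h\<close> is at
  most of order \<open>2 ^ (- n * (b - h * m))\<close>. By Borel-Cantelli only finitely many levels
  are bad.\<close>

lemma (in prob_space) hoelder_paths_of_moments: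
  fixes X :: "real \<Rightarrow> 'a \<Rightarrow> real"
  assumes meas: "\<And>t. t \<in> {0..1} \<Longrightarrow> X t \<in> borel_measurable M"
    and cont: "\<And>\<omega>. \<omega> \<in> space M \<Longrightarrow> continuous_on {0..1} (\<lambda>t. X t \<omega>)"
    and m: "even m" and h: "0 < h" "h * real m < b" and c: "0 \<le> c"
    and int: "\<And>s t. s \<in> {0..1} \<Longrightarrow> t \<in> {0..1} \<Longrightarrow> integrable M (\<lambda>\<omega>. (X t \<omega> - X s \<omega>) ^ m)"
    and moment: "\<And>s t. s \<in> {0..1} \<Longrightarrow> t \<in> {0..1} \<Longrightarrow>
       expectation (\<lambda>\<omega>. (X t \<omega> - X s \<omega>) ^ m) \<le> c * \<bar>t - s\<bar> powr (1 + b)"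
  shows "AE \<omega> in M. \<exists>K\<ge>0. \<forall>s\<in>{0..1}. \<forall>t\<in>{0..1}. \<bar>X t \<omega> - X s \<omega>\<bar> \<le> K * \<bar>t - s\<bar> powr h"
proof -
  define d where "d = (\<lambda>n. (1 / 2 :: real) ^ n)"
  have d: "0 < d n" for n by (simp add: d_def)
  define E where "E = (\<lambda>n i. {\<omega> \<in> space M. d n powr h \<le> \<bar>X (real (Suc i) / 2 ^ n) \<omega> - X (real i / 2 ^ n) \<omega>\<bar>})"
  define A where "A = (\<lambda>n. \<Union>i<2 ^ n. E n i)"
  have pts: "real (Suc i) / 2 ^ n \<in> {0..1}" "real i / 2 ^ n \<in> {0..1}" if "i < 2 ^ n" for n i
  proof -
    have "real (Suc i) \<le> real (2 ^ n)" using that by (simp only: of_nat_le_iff Suc_le_eq)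
    moreover have "real i \<le> real (Suc i)" by simp
    ultimately have "real (Suc i) \<le> 2 ^ n" "real i \<le> 2 ^ n" by (simp_all del: of_nat_Suc)
    then show "real (Suc i) / 2 ^ n \<in> {0..1}" "real i / 2 ^ n \<in> {0..1}" by (simp_all add: divide_le_eq)
  qed
  have Em: "E n i \<in> sets M" if "i < 2 ^ n" for n i
    unfolding E_def using meas[OF pts(1)[OF that]] meas[OF pts(2)[OF that]] by measurable
  have Am: "A n \<in> sets M" for n unfolding A_def using Em by (intro sets.finite_UN) auto
  have PE: "prob (E n i) \<le> c * d n powr (1 + b - h * m)" if i: "i < 2 ^ n" for n i
  proof -
    let ?Y = "\<lambda>\<omega>. X (real (Suc i) / 2 ^ n) \<omega> - X (real i / 2 ^ n) \<omega>"
    have I: "integrable M (\<lambda>\<omega>. ?Y \<omega> ^ m)" by (rule int[OF pts(2)[OF i] pts(1)[OF i]])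
    have "E n i \<subseteq> {\<omega> \<in> space M. (d n powr h) ^ m \<le> ?Y \<omega> ^ m}"
    proof
      fix \<omega> assume "\<omega> \<in> E n i"
      then have "\<omega> \<in> space M" "(d n powr h) ^ m \<le> \<bar>?Y \<omega>\<bar> ^ m"
        by (auto simp: E_def intro: power_mono)
      then show "\<omega> \<in> {\<omega> \<in> space M. (d n powr h) ^ m \<le> ?Y \<omega> ^ m}"
        using m by (simp add: power_even_abs)
    qed
    moreover have "{\<omega> \<in> space M. (d n powr h) ^ m \<le> ?Y \<omega> ^ m} \<in> sets M"
      using borel_measurable_integrable[OF I] by measurable
    ultimately have "prob (E n i) \<le> prob {\<omega> \<in> space M. (d n powr h) ^ m \<le> ?Y \<omega> ^ m}"
      by (rule finite_measure_mono)
    also have "\<dots> \<le> expectation (\<lambda>\<omega>. ?Y \<omega> ^ m) / (d n powr h) ^ m"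
      by (rule integral_Markov_inequality_measure[OF I sets.empty_sets])
        (use m d[of n] in \<open>auto simp: zero_le_even_power\<close>)
    also have "\<dots> \<le> (c * \<bar>real (Suc i) / 2 ^ n - real i / 2 ^ n\<bar> powr (1 + b)) / (d n powr h) ^ m"
      by (rule divide_right_mono[OF moment[OF pts(2)[OF i] pts(1)[OF i]]]) simp
    also have "\<bar>real (Suc i) / 2 ^ n - real i / 2 ^ n\<bar> = d n"
      by (simp add: d_def power_one_over flip: diff_divide_distrib)
    also have "(c * d n powr (1 + b)) / (d n powr h) ^ m = c * d n powr (1 + b - h * m)"
      using d[of n] by (simp add: powr_diff powr_powr flip: powr_realpow)
    finally show ?thesis .
  qed
  have PA: "prob (A n) \<le> c * ((1 / 2) powr (b - h * m)) ^ n" for n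
  proof -
    have "prob (A n) \<le> (\<Sum>i<2 ^ n. prob (E n i))"
      unfolding A_def using Em by (intro finite_measure_subadditive_finite) auto
    also have "\<dots> \<le> (\<Sum>i<(2::nat) ^ n. c * d n powr (1 + b - h * m))"
      using PE by (intro sum_mono) auto
    also have "\<dots> = c * (2 ^ n * d n powr (1 + (b - h * m)))" by (simp add: add_diff_eq)
    also have "\<dots> = c * d n powr (b - h * m)"
      using d[of n] unfolding powr_add by (simp add: d_def power_one_over)
    also have "d n powr (b - h * m) = ((1 / 2) powr (b - h * m)) ^ n"
      by (simp add: d_def powr_powr powr_realpow[symmetric] mult.commute)
    finally show ?thesis .
  qed
  have "(1 / 2) powr (b - h * m) < (1 / 2 :: real) powr 0"
    by (rule powr_less_mono') (use h in auto)
  then have "summable (\<lambda>n. c * ((1 / 2) powr (b - h * m)) ^ n)"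
    by (intro summable_mult summable_geometric) auto
  then have "summable (\<lambda>n. prob (A n))"
    by (rule summable_comparison_test_ev[rotated]) (use PA in auto)
  then have "AE \<omega> in M. \<forall>\<^sub>F n in sequentially. \<omega> \<in> space M - A n"
    by (intro borel_cantelli_AE1 Am) (auto simp: emeasure_eq_measure)
  then show ?thesis
  proof (eventually_elim)
    case (elim \<omega>)
    then obtain N where N: "\<And>n. N \<le> n \<Longrightarrow> \<omega> \<in> space M - A n"
      by (auto simp: eventually_sequentially)
    then have \<omega>: "\<omega> \<in> space M" by blast
    define Y where "Y = (\<lambda>n i. \<bar>X (real (Suc i) / 2 ^ n) \<omega> - X (real i / 2 ^ n) \<omega>\<bar>)"
    \<comment> \<open>The \<open>1\<close> covers the levels from \<open>N\<close> on. The finitely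
      many coarser increments are absorbed by adding all their quotients.\<close>
    define L where "L = 1 + (\<Sum>n<N. \<Sum>i<2 ^ n. Y n i / d n powr h)"
    have Y: "0 \<le> Y n i" for n i by (simp add: Y_def)
    have L: "1 \<le> L" unfolding L_def using Y by (simp add: sum_nonneg)
    show ?case
    proof (rule hoelder_of_dyadic[OF cont[OF \<omega>] h(1), of L])
      show "0 \<le> L" using L by simp
      fix n i :: nat assume i: "i < 2 ^ n"
      have "Y n i \<le> L * d n powr h"
      proof (cases "N \<le> n")
        case True
        then have "\<omega> \<notin> E n i" using N[of n] i by (auto simp: A_def)
        then have "Y n i \<le> 1 * d n powr h" using \<omega> by (simp add: E_def Y_def)
        also have "\<dots> \<le> L * d n powr h" using L by (intro mult_right_mono) auto
        finally show ?thesis .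
      next
        case False
        have "Y n i / d n powr h \<le> (\<Sum>i<2 ^ n. Y n i / d n powr h)"
          using i Y by (intro member_le_sum) auto
        also have "\<dots> \<le> (\<Sum>n<N. \<Sum>i<2 ^ n. Y n i / d n powr h)"
          using False Y by (intro member_le_sum[of n]) (auto intro!: sum_nonneg)
        also have "\<dots> \<le> L" by (simp add: L_def)
        finally show ?thesis using d[of n] by (simp add: divide_le_eq)
      qed
      then show "\<bar>X (real (Suc i) / 2 ^ n) \<omega> - X (real i / 2 ^ n) \<omega>\<bar> \<le> L * ((1 / 2) ^ n) powr h"
        by (simp add: Y_def d_def)
    qed
  qed
qed

section \<open>The integrand along a path\<close>

definition threshold :: "real \<Rightarrow> nat \<Rightarrow> real" where
  "threshold \<kappa> n = ((1 / 2) ^ n) powr \<kappa>"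

lemma threshold_pos [simp]: "0 < threshold \<kappa> n"
  by (simp add: threshold_def)

text \<open>
  The integrand and the accumulated integral at the start of each stage. While no threshold
  is missed, the former is \<open>0\<close> and the latter is the previous target.
\<close>

primrec stage_state :: "real \<Rightarrow> (real \<Rightarrow> real) \<Rightarrow> (real \<Rightarrow> real) \<Rightarrow> nat \<Rightarrow> real \<times> real" where
  "stage_state \<kappa> x \<zeta> 0 = (0, 0)"
| "stage_state \<kappa> x \<zeta> (Suc n) =
    (stage_integrand x (fst (stage_state \<kappa> x \<zeta> n)) (\<zeta> (grid n) - snd (stage_state \<kappa> x \<zeta> n))
       (threshold \<kappa> n) (grid n) (grid (Suc n)),
     snd (stage_state \<kappa> x \<zeta> n) +
     stage_integral x (fst (stage_state \<kappa> x \<zeta> n)) (\<zeta> (grid n) - snd (stage_state \<kappa> x \<zeta> n))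
       (threshold \<kappa> n) (grid n) (grid (Suc n)))"

declare stage_state.simps(2) [simp del]

definition stage_index :: "real \<Rightarrow> nat" where
  "stage_index t = (LEAST n. t < grid (Suc n))"

definition integrand_at :: "real \<Rightarrow> (real \<Rightarrow> real) \<Rightarrow> (real \<Rightarrow> real) \<Rightarrow> nat \<Rightarrow> real \<Rightarrow> real" where
  "integrand_at \<kappa> x \<zeta> n = stage_integrand x (fst (stage_state \<kappa> x \<zeta> n))
     (\<zeta> (grid n) - snd (stage_state \<kappa> x \<zeta> n)) (threshold \<kappa> n) (grid n)"

definition integral_at :: "real \<Rightarrow> (real \<Rightarrow> real) \<Rightarrow> (real \<Rightarrow> real) \<Rightarrow> nat \<Rightarrow> real \<Rightarrow> real" where
  "integral_at \<kappa> x \<zeta> n t = snd (stage_state \<kappa> x \<zeta> n) + stage_integral x (fst (stage_state \<kappa> x \<zeta> n))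
     (\<zeta> (grid n) - snd (stage_state \<kappa> x \<zeta> n)) (threshold \<kappa> n) (grid n) t"

definition integrand :: "real \<Rightarrow> (real \<Rightarrow> real) \<Rightarrow> (real \<Rightarrow> real) \<Rightarrow> real \<Rightarrow> real" where
  "integrand \<kappa> x \<zeta> t = (if t < 1 then integrand_at \<kappa> x \<zeta> (stage_index t) t else 0)"

text \<open>The value at \<open>1\<close> is the one the integral is meant to have. That earlier
  values approach it is part of the tail estimate in
  \<open>integrand_has_rs_integral\<close>.\<close>

definition running_integral :: "real \<Rightarrow> (real \<Rightarrow> real) \<Rightarrow> (real \<Rightarrow> real) \<Rightarrow> real \<Rightarrow> real" where
  "running_integral \<kappa> x \<zeta> t = (if t < 1 then integral_at \<kappa> x \<zeta> (stage_index t) t else \<zeta> 1)"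

lemma stage_index_eq:
  assumes "grid n \<le> t" "t < grid (Suc n)"
  shows "stage_index t = n"
  unfolding stage_index_def
proof (rule Least_equality)
  show "t < grid (Suc n)" by fact
next
  fix m assume "t < grid (Suc m)"
  then show "n \<le> m" using assms(1) grid_mono[of "Suc m" n] by (cases "n \<le> m") auto
qed

text \<open>At the right end \<open>stage_index\<close> has already moved on to
  \<open>Suc n\<close>. The two formulas agree there because \<open>weight\<close> at
  \<open>0\<close> returns the final value carried over in \<open>stage_state\<close>.\<close>

lemma integrand_eq:
  assumes "grid n \<le> t" "t \<le> grid (Suc n)"
  shows "integrand \<kappa> x \<zeta> t = integrand_at \<kappa> x \<zeta> n t"
proof (cases "t = grid (Suc n)")
  case True
  then have "stage_index t = Suc n" using stage_index_eq[of "Suc n" t] grid_less_Suc[of "Suc n"] by simp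
  then show ?thesis using True grid_less_1[of "Suc n"]
    by (simp add: integrand_def integrand_at_def stage_integrand_def[of _ _ _ _ "grid (Suc n)" "grid (Suc n)"] stage_state.simps(2))
next
  case False
  then show ?thesis using stage_index_eq[of n t] assms grid_less_1[of "Suc n"] by (simp add: integrand_def)
qed

lemma running_integral_eq:
  assumes "grid n \<le> t" "t \<le> grid (Suc n)"
  shows "running_integral \<kappa> x \<zeta> t = integral_at \<kappa> x \<zeta> n t"
proof (cases "t = grid (Suc n)")
  case True
  then have "stage_index t = Suc n" using stage_index_eq[of "Suc n" t] grid_less_Suc[of "Suc n"] by simp
  then show ?thesis using True grid_less_1[of "Suc n"]
    by (simp add: running_integral_def integral_at_def stage_integral_def[of _ _ _ _ "grid (Suc n)" "grid (Suc n)"] stage_state.simps(2))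
next
  case False
  then show ?thesis using stage_index_eq[of n t] assms grid_less_1[of "Suc n"] by (simp add: running_integral_def)
qed

lemma running_integral_0 [simp]: "running_integral \<kappa> x \<zeta> 0 = 0"
  using running_integral_eq[of 0 0 \<kappa> x \<zeta>] grid_nonneg[of "Suc 0"]
  by (simp add: integral_at_def stage_integral_def)

lemma running_integral_grid [simp]: "running_integral \<kappa> x \<zeta> (grid n) = snd (stage_state \<kappa> x \<zeta> n)"
  using running_integral_eq[of n "grid n" \<kappa> x \<zeta>] grid_less_Suc[of n]
  by (simp add: integral_at_def stage_integral_def)

lemma integrand_grid [simp]: "integrand \<kappa> x \<zeta> (grid n) = fst (stage_state \<kappa> x \<zeta> n)"
  using integrand_eq[of n "grid n" \<kappa> x \<zeta>] grid_less_Suc[of n]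
  by (simp add: integrand_at_def stage_integrand_def)

text \<open>Each stage aims at the absolute level \<open>\<zeta> (grid n)\<close>, so one success
  erases the effect of all earlier misses.\<close>

lemma stage_state_after_hit:
  assumes "threshold \<kappa> n \<le> \<bar>x (grid (Suc n)) - x (grid n)\<bar>"
  shows "stage_state \<kappa> x \<zeta> (Suc n) = (0, \<zeta> (grid n))"
proof -
  have "hit x (threshold \<kappa> n) (grid n) (grid (Suc n))"
    using assms grid_less_Suc[of n] unfolding hit_def by (intro bexI[of _ "grid (Suc n)"]) auto
  then show ?thesis by (simp add: stage_state.simps(2) stage_integrand_def stage_integral_def)
qed

context
  fixes x \<zeta> :: "real \<Rightarrow> real" and \<kappa> h \<theta> K Kz :: real
  assumes h: "1 / 2 < h" "h \<le> \<kappa>" and \<theta>: "0 < \<theta>" "2 * \<kappa> - \<theta> < 2 * h" and K: "0 \<le> K" and Kz: "0 \<le> Kz"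
    and cont: "continuous_on {0..1} x"
    and hoelder: "\<And>s t. s \<in> {0..1} \<Longrightarrow> t \<in> {0..1} \<Longrightarrow> \<bar>x t - x s\<bar> \<le> K * \<bar>t - s\<bar> powr h"
    and \<zeta>_hoelder: "\<And>s t. s \<in> {0..1} \<Longrightarrow> t \<in> {0..1} \<Longrightarrow> \<bar>\<zeta> t - \<zeta> s\<bar> \<le> Kz * \<bar>t - s\<bar> powr \<theta>"
begin

abbreviation stage_lip :: "nat \<Rightarrow> real" where
  "stage_lip n \<equiv> lip (fst (stage_state \<kappa> x \<zeta> n)) (\<zeta> (grid n) - snd (stage_state \<kappa> x \<zeta> n)) (threshold \<kappa> n)"

lemma stage_subset: "{grid n..grid (Suc n)} \<subseteq> {0..1}"
  using grid_nonneg[of n] grid_less_1[of "Suc n"] by auto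

lemma integrand_stage_hoelder:
  assumes "grid n \<le> p" "p \<le> q" "q \<le> grid (Suc n)"
  shows "\<bar>integrand \<kappa> x \<zeta> q - integrand \<kappa> x \<zeta> p\<bar> \<le> stage_lip n * K * (q - p) powr h"
proof -
  have "integrand \<kappa> x \<zeta> q = integrand_at \<kappa> x \<zeta> n q" "integrand \<kappa> x \<zeta> p = integrand_at \<kappa> x \<zeta> n p"
    using assms by (auto intro!: integrand_eq)
  moreover have "\<bar>integrand_at \<kappa> x \<zeta> n q - integrand_at \<kappa> x \<zeta> n p\<bar> \<le> stage_lip n * K * (q - p) powr h"
    unfolding integrand_at_def
    by (rule stage_integrand_hoelder[OF threshold_pos _ K continuous_on_subset[OF cont stage_subset] _ assms])
      (use h stage_subset[of n] hoelder in auto)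
  ultimately show ?thesis by simp
qed

lemma integrand_stage_error:
  assumes "grid n \<le> p" "p \<le> q" "q \<le> grid (Suc n)"
  shows "\<bar>integrand \<kappa> x \<zeta> p * (x q - x p) - (running_integral \<kappa> x \<zeta> q - running_integral \<kappa> x \<zeta> p)\<bar>
     \<le> 2 * stage_lip n * K\<^sup>2 * (q - p) powr (2 * h)"
proof -
  have "integrand \<kappa> x \<zeta> p = integrand_at \<kappa> x \<zeta> n p"
    "running_integral \<kappa> x \<zeta> p = integral_at \<kappa> x \<zeta> n p"
    "running_integral \<kappa> x \<zeta> q = integral_at \<kappa> x \<zeta> n q"
    using assms by (auto intro!: integrand_eq running_integral_eq)
  moreover have "\<bar>integrand_at \<kappa> x \<zeta> n p * (x q - x p) - (integral_at \<kappa> x \<zeta> n q - integral_at \<kappa> x \<zeta> n p)\<bar>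
     \<le> 2 * stage_lip n * K\<^sup>2 * (q - p) powr (2 * h)"
    unfolding integrand_at_def integral_at_def add_diff_cancel_left
    by (rule stage_error[OF threshold_pos _ K continuous_on_subset[OF cont stage_subset] _ assms])
      (use h stage_subset[of n] hoelder in auto)
  ultimately show ?thesis by simp
qed

text \<open>Continuity on closed stages comes from the Hoelder bound. The stages are glued to
  intervals \<open>[0, grid n]\<close>, and every time before \<open>1\<close> is interior, relative
  to \<open>[0, 1)\<close>, to one of these.\<close>

lemma integrand_continuous: "continuous_on {0..<1} (integrand \<kappa> x \<zeta>)"
proof -
  have stage: "continuous_on {grid n..grid (Suc n)} (integrand \<kappa> x \<zeta>)" for n
    unfolding continuous_on_def
  proof
    fix s assume s: "s \<in> {grid n..grid (Suc n)}"
    have B: "\<bar>integrand \<kappa> x \<zeta> t - integrand \<kappa> x \<zeta> s\<bar> \<le> stage_lip n * K * \<bar>t - s\<bar> powr h"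
      if "t \<in> {grid n..grid (Suc n)}" for t
      using integrand_stage_hoelder[of n s t] integrand_stage_hoelder[of n t s] s that
      by (cases "s \<le> t") (auto simp: abs_minus_commute)
    have "((\<lambda>t. \<bar>t - s\<bar> powr h) \<longlongrightarrow> \<bar>s - s\<bar> powr h) (at s within {grid n..grid (Suc n)})"
      using h by (intro tendsto_intros) auto
    then have "((\<lambda>t. stage_lip n * K * \<bar>t - s\<bar> powr h) \<longlongrightarrow> 0) (at s within {grid n..grid (Suc n)})"
      by (intro tendsto_mult_right_zero) simp
    then have "((\<lambda>t. integrand \<kappa> x \<zeta> t - integrand \<kappa> x \<zeta> s) \<longlongrightarrow> 0) (at s within {grid n..grid (Suc n)})"
      by (rule Lim_null_comparison[rotated]) (use B in \<open>auto simp: eventually_at_filter\<close>)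
    then show "(integrand \<kappa> x \<zeta> \<longlongrightarrow> integrand \<kappa> x \<zeta> s) (at s within {grid n..grid (Suc n)})"
      by (rule LIM_zero_cancel)
  qed
  have initial: "continuous_on {0..grid n} (integrand \<kappa> x \<zeta>)" for n
  proof (induction n)
    case (Suc n)
    have "{0..grid (Suc n)} = {0..grid n} \<union> {grid n..grid (Suc n)}"
      using grid_nonneg[of n] grid_less_Suc[of n] by auto
    then show ?case using continuous_on_closed_Un[OF _ _ Suc stage[of n]] by simp
  qed simp
  show ?thesis
    unfolding continuous_on_eq_continuous_within
  proof
    fix s :: real assume s: "s \<in> {0..<1}"
    then obtain n where n: "s < grid (Suc n)" using grid_interval[of s] by auto
    have "continuous (at s within {0..grid (Suc n)}) (integrand \<kappa> x \<zeta>)"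
      using initial[of "Suc n"] s n by (auto simp: continuous_on_eq_continuous_within)
    moreover have "at s within {0..<1} = at s within {0..grid (Suc n)}"
      by (rule at_within_nhd[of s "{..<grid (Suc n)}"]) (use s n grid_less_1[of "Suc n"] in auto)
    ultimately show "continuous (at s within {0..<1}) (integrand \<kappa> x \<zeta>)" by simp
  qed
qed

lemma integrand_has_rs_integral:
  assumes hits: "\<forall>\<^sub>F n in sequentially. threshold \<kappa> n \<le> \<bar>x (grid (Suc n)) - x (grid n)\<bar>"
  shows "has_rs_integral (integrand \<kappa> x \<zeta>) x 0 1 (\<zeta> 1)"
proof -
  obtain N where N: "\<And>n. N \<le> n \<Longrightarrow> threshold \<kappa> n \<le> \<bar>x (grid (Suc n)) - x (grid n)\<bar>"
    using hits by (auto simp: eventually_sequentially)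
  note state = stage_state_after_hit[OF N, of _ \<zeta>]
  define d where "d = (\<lambda>n. (1 / 2 :: real) ^ n)"
  have d: "0 < d n" "d n \<le> 1" for n by (auto simp: d_def power_le_one)
  have d_mono: "d n \<le> d m" if "m \<le> n" for m n using that by (simp add: d_def power_decreasing)
  have grid01: "grid n \<in> {0..1}" for n using grid_nonneg[of n] grid_less_1[of n] by auto
  \<comment> \<open>The quotient is the largest \<open>\<rho>\<close> for which
    \<open>d n powr (\<theta> - 2 * \<kappa>) \<le> P n\<close> for all \<open>n\<close>. It is
    positive since \<open>2 * \<kappa> - \<theta> < 2 * h\<close>, and the minimum ensures
    \<open>\<rho> < 1\<close>.\<close>
  define \<rho> where "\<rho> = min (1 / 2) ((2 * h + \<theta> - 2 * \<kappa>) / (2 * h))"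
  have \<rho>: "0 < \<rho>" "\<rho> < 1" using h \<theta> by (auto simp: \<rho>_def)
  have "2 * h * \<rho> \<le> 2 * h * ((2 * h + \<theta> - 2 * \<kappa>) / (2 * h))"
    using h by (intro mult_left_mono) (auto simp: \<rho>_def)
  then have h\<rho>: "2 * h * \<rho> \<le> 2 * h + \<theta> - 2 * \<kappa>" using h by simp
  define P where "P = (\<lambda>n. d n powr (- (2 * h * (1 - \<rho>))))"
  have P1: "1 \<le> P n" for n
    using powr_mono'[of "- (2 * h * (1 - \<rho>))" 0 "d n"] d[of n] h \<rho> by (simp add: P_def)
  have target: "\<bar>\<zeta> (grid (Suc n)) - \<zeta> (grid n)\<bar> \<le> Kz * d (Suc n) powr \<theta>" for n
    using \<zeta>_hoelder[OF grid01[of n] grid01[of "Suc n"]] by (simp add: grid_Suc_diff d_def)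
  \<comment> \<open>After success on stage \<open>n\<close>, the next one starts with integrand
    \<open>0\<close> and has to gain one increment of \<open>\<zeta>\<close>: the first term of
    \<open>lip\<close> vanishes and the second is at most of order
    \<open>?d powr (\<theta> - 2 * \<kappa>)\<close>.\<close>
  have lip_late: "stage_lip (Suc n) \<le> 18 * Kz * P (Suc n)" if "N \<le> n" for n
  proof -
    let ?d = "d (Suc n)"
    have "stage_lip (Suc n) = 18 * \<bar>\<zeta> (grid (Suc n)) - \<zeta> (grid n)\<bar> / (threshold \<kappa> (Suc n))\<^sup>2"
      unfolding state[OF that] by (simp add: lip_def)
    also have "\<dots> \<le> 18 * (Kz * ?d powr \<theta>) / (threshold \<kappa> (Suc n))\<^sup>2"
      by (intro divide_right_mono mult_left_mono target) auto
    also have "(threshold \<kappa> (Suc n))\<^sup>2 = ?d powr (2 * \<kappa>)"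
    proof -
      have "?d powr (2 * \<kappa>) = ?d powr \<kappa> * ?d powr \<kappa>"
        using powr_add[of ?d \<kappa> \<kappa>] by simp
      then show ?thesis by (simp add: threshold_def d_def power2_eq_square)
    qed
    also have "18 * (Kz * ?d powr \<theta>) / ?d powr (2 * \<kappa>) = 18 * Kz * ?d powr (\<theta> - 2 * \<kappa>)"
      by (simp add: powr_diff)
    also have "\<dots> \<le> 18 * Kz * P (Suc n)"
    proof -
      have "- (2 * h * (1 - \<rho>)) \<le> \<theta> - 2 * \<kappa>" using h\<rho> by (simp add: right_diff_distrib)
      then show ?thesis
        unfolding P_def using d[of "Suc n"] Kz by (intro mult_left_mono powr_mono') auto
    qed
    finally show ?thesis .
  qed
  \<comment> \<open>The sum includes stage \<open>N\<close> itself, whose initial state depends on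
    stage \<open>N - 1\<close>, which may have missed its threshold.\<close>
  define L where "L = 18 * Kz + (\<Sum>n\<le>N. stage_lip n)"
  have lip0: "0 \<le> stage_lip n" for n by (intro lip_nonneg threshold_pos)
  have S0: "0 \<le> (\<Sum>n\<le>N. stage_lip n)" by (intro sum_nonneg lip0)
  have L: "0 \<le> L" using Kz S0 by (simp add: L_def)
  have lipL: "stage_lip n \<le> L * P n" for n
  proof (cases "n \<le> N")
    case True
    have "stage_lip n \<le> (\<Sum>n\<le>N. stage_lip n)" using True lip0 by (intro member_le_sum) auto
    also have "\<dots> \<le> L" using Kz by (simp add: L_def)
    also have "\<dots> \<le> L * P n" using P1[of n] L by (simp add: mult_le_cancel_left1)
    finally show ?thesis .
  next
    case False
    then obtain k where k: "n = Suc k" "N \<le> k" by (cases n) auto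
    have "stage_lip n \<le> 18 * Kz * P n" using lip_late[OF k(2)] k(1) by simp
    also have "\<dots> \<le> L * P n" using S0 P1[of n] by (intro mult_right_mono) (auto simp: L_def)
    finally show ?thesis .
  qed
  define \<Lambda> where "\<Lambda> = 2 * L * K\<^sup>2 + L * K + Kz * (1 + 2 powr \<theta>)"
  have \<Lambda>: "0 \<le> \<Lambda>" "2 * L * K\<^sup>2 \<le> \<Lambda>" "L * K \<le> \<Lambda>" "Kz * (1 + 2 powr \<theta>) \<le> \<Lambda>"
    using L K Kz by (auto simp: \<Lambda>_def)
  have "has_rs_integral (integrand \<kappa> x \<zeta>) x 0 1 (running_integral \<kappa> x \<zeta> 1 - running_integral \<kappa> x \<zeta> 0)"
  proof (rule has_rs_integral_grid[OF h(1) \<rho> K \<Lambda>(1) hoelder])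
    fix n p q assume pq: "grid n \<le> p" "p \<le> q" "q \<le> grid (Suc n)"
    have "2 * stage_lip n * K\<^sup>2 * (q - p) powr (2 * h) \<le> 2 * (L * P n) * K\<^sup>2 * (q - p) powr (2 * h)"
      by (intro mult_right_mono mult_left_mono lipL) auto
    also have "\<dots> = (2 * L * K\<^sup>2) * P n * (q - p) powr (2 * h)" by simp
    also have "\<dots> \<le> \<Lambda> * P n * (q - p) powr (2 * h)"
      using P1[of n] by (intro mult_right_mono \<Lambda>(2)) auto
    finally show "\<bar>integrand \<kappa> x \<zeta> p * (x q - x p) - (running_integral \<kappa> x \<zeta> q - running_integral \<kappa> x \<zeta> p)\<bar>
       \<le> \<Lambda> * ((1 / 2) ^ n) powr (- (2 * h * (1 - \<rho>))) * (q - p) powr (2 * h)"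
      using integrand_stage_error[OF pq] unfolding P_def d_def by linarith
    have "stage_lip n * K * (q - p) powr h \<le> (L * P n) * K * (q - p) powr h"
      by (intro mult_right_mono mult_left_mono lipL K) auto
    also have "\<dots> = (L * K) * P n * (q - p) powr h" by simp
    also have "\<dots> \<le> \<Lambda> * P n * (q - p) powr h"
      using P1[of n] by (intro mult_right_mono \<Lambda>(3)) auto
    finally show "\<bar>integrand \<kappa> x \<zeta> q - integrand \<kappa> x \<zeta> p\<bar>
       \<le> \<Lambda> * ((1 / 2) ^ n) powr (- (2 * h * (1 - \<rho>))) * (q - p) powr h"
      using integrand_stage_hoelder[OF pq] unfolding P_def d_def by linarith
  next
    \<comment> \<open>From \<open>Suc N\<close> on, \<open>m\<close> follows a successful stage
      \<open>k\<close>, so the integrand vanishes at \<open>grid m\<close> and only the running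
      integral contributes.\<close>
    fix m q assume m: "Suc N \<le> m" and q: "grid (Suc m) \<le> q" "q \<le> 1"
    obtain k where k: "m = Suc k" "N \<le> k" using m by (cases m) auto
    \<comment> \<open>The factor \<open>2 powr \<theta>\<close> arises from
      \<open>1 - grid k = 2 * d m\<close>.\<close>
    have near: "\<bar>\<zeta> t - \<zeta> (grid k)\<bar> \<le> Kz * (2 powr \<theta> * d m powr \<theta>)" if "t \<in> {grid k..1}" for t
    proof -
      have "\<bar>\<zeta> t - \<zeta> (grid k)\<bar> \<le> Kz * \<bar>t - grid k\<bar> powr \<theta>"
        using that grid01[of k] by (intro \<zeta>_hoelder) auto
      also have "\<dots> \<le> Kz * (2 * d m) powr \<theta>"
        using that Kz \<theta> by (intro mult_left_mono powr_mono2) (auto simp: k d_def grid_def)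
      finally show ?thesis using d[of m] by (simp add: powr_mult)
    qed
    have V: "\<bar>running_integral \<kappa> x \<zeta> q - \<zeta> (grid k)\<bar> \<le> Kz * (1 + 2 powr \<theta>) * d m powr \<theta>"
    proof (cases "q = 1")
      case True
      have "Kz * (2 powr \<theta> * d m powr \<theta>) \<le> Kz * (1 + 2 powr \<theta>) * d m powr \<theta>"
        using Kz by (simp add: algebra_simps)
      then show ?thesis using near[of 1] grid01[of k] True by (simp add: running_integral_def)
    next
      case False
      have "0 \<le> q" using q grid_nonneg[of "Suc m"] by simp
      then obtain n where n: "grid n \<le> q" "q < grid (Suc n)" using grid_interval[of q] q False by auto
      have "m \<le> n" using n q grid_mono[of "Suc n" m] grid_less_Suc[of m] by (cases "m \<le> n") auto
      then obtain i where i: "n = Suc i" "N \<le> i" "k \<le> i" using k by (cases n) auto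
      let ?y = "\<zeta> (grid n) - \<zeta> (grid i)"
      \<comment> \<open>On stage \<open>n\<close> the running integral is the previous target plus a
        part of the gain \<open>?y\<close>, and \<open>primitive_bound\<close> excludes
        overshooting.\<close>
      have "running_integral \<kappa> x \<zeta> q = \<zeta> (grid i) + stage_integral x 0 ?y (threshold \<kappa> n) (grid n) q"
        using running_integral_eq[of n q \<kappa> x \<zeta>] n state[OF i(2)] by (simp add: integral_at_def i(1))
      moreover have "\<bar>stage_integral x 0 ?y (threshold \<kappa> n) (grid n) q\<bar> \<le> \<bar>?y\<bar>"
        using primitive_bound[OF less_imp_le[OF not_hit_bound], of x "threshold \<kappa> n" "grid n" q q ?y] n
        by (auto simp: stage_integral_def)
      moreover have "\<bar>?y\<bar> \<le> Kz * d n powr \<theta>" using target[of i] i(1) by simp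
      moreover have "Kz * d n powr \<theta> \<le> Kz * d m powr \<theta>"
        using d_mono[OF \<open>m \<le> n\<close>] d[of n] Kz \<theta> by (intro mult_left_mono powr_mono2) auto
      moreover have "\<bar>\<zeta> (grid i) - \<zeta> (grid k)\<bar> \<le> Kz * (2 powr \<theta> * d m powr \<theta>)"
        using grid_mono[OF i(3)] grid01[of i] by (intro near) auto
      ultimately show ?thesis by (simp add: algebra_simps)
    qed
    have "\<bar>integrand \<kappa> x \<zeta> (grid m) * (x q - x (grid m)) - (running_integral \<kappa> x \<zeta> q - running_integral \<kappa> x \<zeta> (grid m))\<bar>
       = \<bar>running_integral \<kappa> x \<zeta> q - \<zeta> (grid k)\<bar>"
      by (simp add: k(1) state[OF k(2)] abs_minus_commute)
    also have "\<dots> \<le> Kz * (1 + 2 powr \<theta>) * d m powr \<theta>" by (rule V)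
    \<comment> \<open>From \<open>h\<rho>\<close> and \<open>h \<le> \<kappa>\<close> follows
      \<open>2 * h * \<rho> \<le> \<theta>\<close>, and \<open>d m \<le> 1\<close>.\<close>
    also have "\<dots> \<le> \<Lambda> * d m powr (2 * h * \<rho>)"
      using h\<rho> h d[of m] \<Lambda> Kz by (intro mult_mono powr_mono') auto
    finally show "\<bar>integrand \<kappa> x \<zeta> (grid m) * (x q - x (grid m)) -
        (running_integral \<kappa> x \<zeta> q - running_integral \<kappa> x \<zeta> (grid m))\<bar>
       \<le> \<Lambda> * ((1 / 2) ^ m) powr (2 * h * \<rho>)" by (simp add: d_def)
  qed
  then show ?thesis by (simp add: running_integral_def[of _ _ _ 1])
qed

end

section \<open>Adaptedness\<close>

text \<open>Turns an uncountable existential into countable operations. The supremum over rational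
  positions is the maximum over \<open>[a, t]\<close> but need not be attained at one of them, hence
  the slack \<open>1 / real (Suc k)\<close>. Relative positions \<open>r\<close> keep the sampled
  times inside \<open>[a, t]\<close>, even if \<open>a = t\<close>.\<close>

lemma hit_iff_rational:
  assumes "a \<le> t" "continuous_on {a..t} x"
  shows "hit x \<epsilon> a t \<longleftrightarrow> (\<forall>k. \<exists>r\<in>{0<..<1} \<inter> \<rat>. \<epsilon> - 1 / real (Suc k) < \<bar>x (a + r * (t - a)) - x a\<bar>)"
    (is "_ \<longleftrightarrow> ?R")
proof -
  define g where "g = (\<lambda>r. \<bar>x (a + r * (t - a)) - x a\<bar>)"
  have range: "a + r * (t - a) \<in> {a..t}" if "r \<in> {0..1}" for r
    using that assms(1) mult_left_le_one_le[of "t - a" r] by auto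
  have cont: "continuous_on {0..1} g"
    unfolding g_def using range
    by (intro continuous_intros continuous_on_compose2[OF assms(2)]) auto
  have closure: "closure ({0<..<1} \<inter> \<rat>) = {0..1::real}"
    using closure_open_Int_superset[of "{0<..<1::real}" \<rat>] by (simp add: Rats_closure_real)
  have hit: "hit x \<epsilon> a t \<longleftrightarrow> (\<exists>r\<in>{0..1}. \<epsilon> \<le> g r)"
  proof
    assume "hit x \<epsilon> a t"
    then obtain s where s: "s \<in> {a..t}" "\<epsilon> \<le> \<bar>x s - x a\<bar>" by (auto simp: hit_def)
    show "\<exists>r\<in>{0..1}. \<epsilon> \<le> g r"
    proof (cases "a = t")
      case True
      then show ?thesis using s by (intro bexI[of _ 0]) (auto simp: g_def)
    next
      case False
      then show ?thesis using s assms(1)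
        by (intro bexI[of _ "(s - a) / (t - a)"]) (auto simp: g_def divide_le_eq)
    qed
  next
    assume "\<exists>r\<in>{0..1}. \<epsilon> \<le> g r"
    then show "hit x \<epsilon> a t" using range unfolding hit_def g_def by blast
  qed
  show ?thesis
  proof
    assume "hit x \<epsilon> a t"
    then obtain s where s: "s \<in> {0..1}" "\<epsilon> \<le> g s" using hit by blast
    show ?R
    proof (rule ccontr)
      assume "\<not> ?R"
      then obtain k where "\<forall>r\<in>{0<..<1} \<inter> \<rat>. \<not> \<epsilon> - 1 / real (Suc k) < g r"
        unfolding g_def by blast
      then have "g r \<le> \<epsilon> - 1 / real (Suc k)" if "r \<in> {0<..<1} \<inter> \<rat>" for r
        using that not_less by blast
      then have "g s \<le> \<epsilon> - 1 / real (Suc k)"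
        using continuous_le_on_closure[of "{0<..<1} \<inter> \<rat>" g s] cont s(1) closure by simp
      moreover have "0 < 1 / real (Suc k)" by simp
      ultimately show False using s(2) by linarith
    qed
  next
    assume R: ?R
    obtain m where m: "m \<in> {0..1}" "\<And>r. r \<in> {0..1} \<Longrightarrow> g r \<le> g m"
      using continuous_attains_sup[OF _ _ cont] by auto
    have "\<epsilon> \<le> g m"
    proof (rule ccontr)
      assume "\<not> \<epsilon> \<le> g m"
      then obtain k where "1 / real (Suc k) < \<epsilon> - g m"
        using reals_Archimedean[of "\<epsilon> - g m"] by (auto simp: inverse_eq_divide)
      moreover obtain r where "r \<in> {0<..<1} \<inter> \<rat>" "\<epsilon> - 1 / real (Suc k) < g r"
        using R unfolding g_def by blast
      moreover from this have "g r \<le> g m" by (intro m) auto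
      ultimately show False by linarith
    qed
    then show "hit x \<epsilon> a t" using hit m(1) by blast
  qed
qed

lemma measurable_stage:
  fixes X :: "real \<Rightarrow> 'a \<Rightarrow> real"
  assumes "a \<le> t" and X: "\<And>s. s \<in> {a..t} \<Longrightarrow> X s \<in> borel_measurable N"
    and cont: "\<And>\<omega>. \<omega> \<in> space N \<Longrightarrow> continuous_on {a..t} (\<lambda>s. X s \<omega>)"
    and w [measurable]: "w \<in> borel_measurable N" and y [measurable]: "y \<in> borel_measurable N"
  shows "(\<lambda>\<omega>. stage_integrand (\<lambda>s. X s \<omega>) (w \<omega>) (y \<omega>) \<epsilon> a t) \<in> borel_measurable N"
    and "(\<lambda>\<omega>. stage_integral (\<lambda>s. X s \<omega>) (w \<omega>) (y \<omega>) \<epsilon> a t) \<in> borel_measurable N"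
proof -
  have [measurable]: "X a \<in> borel_measurable N" "X t \<in> borel_measurable N"
    using X assms(1) by auto
  have "Measurable.pred N (\<lambda>\<omega>. \<epsilon> - 1 / real (Suc k) < \<bar>X (a + r * (t - a)) \<omega> - X a \<omega>\<bar>)"
    if "r \<in> {0<..<1} \<inter> \<rat>" for r k
  proof -
    have [measurable]: "X (a + r * (t - a)) \<in> borel_measurable N"
      using that assms(1) mult_left_le_one_le[of "t - a" r] by (intro X) auto
    show ?thesis by measurable
  qed
  then have "Measurable.pred N (\<lambda>\<omega>. \<forall>k. \<exists>r\<in>{0<..<1} \<inter> \<rat>. \<epsilon> - 1 / real (Suc k) < \<bar>X (a + r * (t - a)) \<omega> - X a \<omega>\<bar>)"
    by (intro pred_intros_countable(1) measurable_pred_countable(2) countable_Int2 countable_rat)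
  then have hit [measurable]: "Measurable.pred N (\<lambda>\<omega>. hit (\<lambda>s. X s \<omega>) \<epsilon> a t)"
    by (rule measurable_cong[THEN iffD2, rotated]) (rule hit_iff_rational[OF assms(1) cont])
  show "(\<lambda>\<omega>. stage_integrand (\<lambda>s. X s \<omega>) (w \<omega>) (y \<omega>) \<epsilon> a t) \<in> borel_measurable N"
    unfolding stage_integrand_def weight_def by measurable
  show "(\<lambda>\<omega>. stage_integral (\<lambda>s. X s \<omega>) (w \<omega>) (y \<omega>) \<epsilon> a t) \<in> borel_measurable N"
    unfolding stage_integral_def primitive_def by measurable
qed

section \<open>The natural filtration and adaptedness of the integrand\<close>

lemma space_natural_filtration [simp]: "space (natural_filtration M X t) = space M"
  by (simp add: natural_filtration_def space_measure_of_conv)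

lemma sets_natural_filtration:
  "sets (natural_filtration M X t) =
     sigma_sets (space M) {X s -` A \<inter> space M | s A. s \<in> {0..t} \<and> A \<in> sets borel}"
  unfolding natural_filtration_def by (rule sets_measure_of) auto

lemma measurable_natural_filtration:
  assumes "s \<in> {0..t}"
  shows "X s \<in> borel_measurable (natural_filtration M X t)"
proof (rule measurableI)
  fix A :: "real set" assume "A \<in> sets borel"
  then show "X s -` A \<inter> space (natural_filtration M X t) \<in> sets (natural_filtration M X t)"
    unfolding sets_natural_filtration using assms by (auto intro!: sigma_sets.Basic)
qed simp

lemma natural_filtration_mono:
  assumes "f \<in> borel_measurable (natural_filtration M X s)" "s \<le> t"
  shows "f \<in> borel_measurable (natural_filtration M X t)"
proof (rule measurable_from_subalg[OF _ assms(1)])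
  have "sets (natural_filtration M X s) \<subseteq> sets (natural_filtration M X t)"
    unfolding sets_natural_filtration using assms(2) by (intro sigma_sets_mono') force
  then show "subalgebra (natural_filtration M X t) (natural_filtration M X s)"
    by (simp add: subalgebra_def)
qed

text \<open>By induction, the state at the start of stage \<open>n\<close> is known at time
  \<open>grid n\<close>, and the value at \<open>t\<close> adds only the path on
  \<open>[grid n, t]\<close>. As the filtration is not augmented, continuity is assumed for every
  outcome in \<open>space M\<close>.\<close>

lemma integrand_adapted:
  fixes X z :: "real \<Rightarrow> 'a \<Rightarrow> real"
  assumes cont: "\<And>\<omega>. \<omega> \<in> space M \<Longrightarrow> continuous_on {0..1} (\<lambda>t. X t \<omega>)"
    and z: "adapted_process (natural_filtration M X) z"
  shows "adapted_process (natural_filtration M X) (\<lambda>t \<omega>. integrand \<kappa> (\<lambda>s. X s \<omega>) (\<lambda>s. z s \<omega>) t)"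
proof -
  let ?F = "natural_filtration M X"
  let ?S = "\<lambda>n \<omega>. stage_state \<kappa> (\<lambda>s. X s \<omega>) (\<lambda>s. z s \<omega>) n"
  have X: "X s \<in> borel_measurable (?F t)" if "s \<in> {grid n..t}" for s t n
    using that grid_nonneg[of n] by (intro measurable_natural_filtration) auto
  have sub: "continuous_on {grid n..t} (\<lambda>s. X s \<omega>)" if "t \<le> 1" "\<omega> \<in> space (?F t)" for n t \<omega>
    using continuous_on_subset[OF cont] grid_nonneg[of n] that by auto
  have zg: "z (grid n) \<in> borel_measurable (?F (grid n))" for n
    using z grid_nonneg[of n] grid_less_1[of n] by (auto simp: adapted_process_def)
  have stage: "(\<lambda>\<omega>. stage_integrand (\<lambda>s. X s \<omega>) (fst (?S n \<omega>)) (z (grid n) \<omega> - snd (?S n \<omega>)) (threshold \<kappa> n) (grid n) t)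
      \<in> borel_measurable (?F t)"
     "(\<lambda>\<omega>. stage_integral (\<lambda>s. X s \<omega>) (fst (?S n \<omega>)) (z (grid n) \<omega> - snd (?S n \<omega>)) (threshold \<kappa> n) (grid n) t)
      \<in> borel_measurable (?F t)"
    if "(\<lambda>\<omega>. fst (?S n \<omega>)) \<in> borel_measurable (?F (grid n))" "(\<lambda>\<omega>. snd (?S n \<omega>)) \<in> borel_measurable (?F (grid n))"
      "grid n \<le> t" "t \<le> 1" for n t
    by (intro measurable_stage that X sub borel_measurable_diff natural_filtration_mono[OF that(1) that(3)]
        natural_filtration_mono[OF that(2) that(3)] natural_filtration_mono[OF zg that(3)]; assumption)+
  have state: "(\<lambda>\<omega>. fst (?S n \<omega>)) \<in> borel_measurable (?F (grid n)) \<and>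
     (\<lambda>\<omega>. snd (?S n \<omega>)) \<in> borel_measurable (?F (grid n))" for n
  proof (induction n)
    case (Suc n)
    have le: "grid n \<le> grid (Suc n)" "grid (Suc n) \<le> 1" using grid_less_Suc[of n] grid_less_1[of "Suc n"] by auto
    show ?case
      using stage[OF conjunct1[OF Suc] conjunct2[OF Suc] le] natural_filtration_mono[OF conjunct2[OF Suc] le(1)]
      by (simp add: stage_state.simps(2))
  qed simp
  show ?thesis
    unfolding adapted_process_def
  proof
    fix t :: real assume t: "t \<in> {0..1}"
    show "(\<lambda>\<omega>. integrand \<kappa> (\<lambda>s. X s \<omega>) (\<lambda>s. z s \<omega>) t) \<in> borel_measurable (?F t)"
    proof (cases "t < 1")
      case True
      then obtain n where n: "grid n \<le> t" "t < grid (Suc n)" using grid_interval[of t] t by auto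
      then show ?thesis
        using stage(1)[of n t] state[of n] t by (simp add: integrand_eq integrand_at_def)
    qed (simp add: integrand_def)
  qed
qed

section \<open>Gaussian estimates\<close>

context prob_space
begin

lemma gaussian_rv_integrable:
  assumes "gaussian_rv M Y"
  shows "integrable M Y"
proof -
  obtain \<mu> \<sigma> where Y: "Y \<in> borel_measurable M" "0 \<le> \<sigma>"
    "if \<sigma> = 0 then AE \<omega> in M. Y \<omega> = \<mu> else distributed M lborel Y (\<lambda>x. ennreal (normal_density \<mu> \<sigma> x))"
    using assms by (auto simp: gaussian_rv_def)
  show ?thesis
  proof (cases "\<sigma> = 0")
    case True
    then have "integrable M Y \<longleftrightarrow> integrable M (\<lambda>_. \<mu>)"
      using Y by (intro integrable_cong_AE) auto
    then show ?thesis by simp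
  next
    case False
    then show ?thesis
      using Y by (intro distributed_integrable_var[of M Y "normal_density \<mu> \<sigma>"] integrable_normal_moment_nz_1)
        (auto simp: normal_density_nonneg)
  qed
qed

text \<open>\<open>gaussian_rv\<close> only provides some mean and deviation. At mean zero, a
  positive second moment excludes the point mass, and the first two moments identify the
  parameters.\<close>

lemma gaussian_rv_centered:
  assumes G: "gaussian_rv M Y" and "expectation Y = 0" and v: "0 < expectation (\<lambda>\<omega>. (Y \<omega>)\<^sup>2)"
  shows "distributed M lborel Y (\<lambda>x. ennreal (normal_density 0 (sqrt (expectation (\<lambda>\<omega>. (Y \<omega>)\<^sup>2))) x))"
proof -
  obtain \<mu> \<sigma> where Y: "Y \<in> borel_measurable M" "0 \<le> \<sigma>"
    "if \<sigma> = 0 then AE \<omega> in M. Y \<omega> = \<mu> else distributed M lborel Y (\<lambda>x. ennreal (normal_density \<mu> \<sigma> x))"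
    using G by (auto simp: gaussian_rv_def)
  have "\<sigma> \<noteq> 0"
  proof
    assume "\<sigma> = 0"
    then have ae: "AE \<omega> in M. Y \<omega> = \<mu>" using Y by simp
    have "expectation Y = expectation (\<lambda>_. \<mu>)" using Y(1) ae by (intro integral_cong_AE) auto
    then have "\<mu> = 0" using assms(2) by (simp add: prob_space)
    then have "expectation (\<lambda>\<omega>. (Y \<omega>)\<^sup>2) = expectation (\<lambda>_. 0)"
      using Y(1) ae by (intro integral_cong_AE) auto
    then show False using v by simp
  qed
  then have D: "distributed M lborel Y (\<lambda>x. ennreal (normal_density \<mu> \<sigma> x))" and \<sigma>: "0 < \<sigma>"
    using Y by auto
  have "(\<integral>x. normal_density \<mu> \<sigma> x * x \<partial>lborel) = expectation Y"
    by (rule distributed_integral[OF D]) (auto simp: normal_density_nonneg)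
  then have \<mu>: "\<mu> = 0" using integral_normal_moment_nz_1[OF \<sigma>] assms(2) by simp
  have "(\<integral>x. normal_density \<mu> \<sigma> x * x\<^sup>2 \<partial>lborel) = expectation (\<lambda>\<omega>. (Y \<omega>)\<^sup>2)"
    by (rule distributed_integral[OF D]) (auto simp: normal_density_nonneg)
  then have "expectation (\<lambda>\<omega>. (Y \<omega>)\<^sup>2) = \<sigma>\<^sup>2"
    using integral_normal_moment_even[OF \<sigma>, of 0 1] by (simp add: \<mu> fact_2)
  then show ?thesis using D \<sigma> \<mu> by simp
qed

lemma normal_even_moment:
  assumes D: "distributed M lborel Y (\<lambda>x. ennreal (normal_density 0 \<sigma> x))" and \<sigma>: "0 < \<sigma>"
  shows "integrable M (\<lambda>\<omega>. Y \<omega> ^ (2 * k))"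
    and "expectation (\<lambda>\<omega>. Y \<omega> ^ (2 * k)) = fact (2 * k) / (2 ^ k * fact k) * (\<sigma>\<^sup>2) ^ k"
proof -
  show "integrable M (\<lambda>\<omega>. Y \<omega> ^ (2 * k))"
    using distributed_integrable[OF D, of "\<lambda>x. x ^ (2 * k)"] integrable_normal_moment[OF \<sigma>, of 0 "2 * k"]
    by (simp add: normal_density_nonneg)
  have "(\<integral>x. normal_density 0 \<sigma> x * x ^ (2 * k) \<partial>lborel) = expectation (\<lambda>\<omega>. Y \<omega> ^ (2 * k))"
    by (rule distributed_integral[OF D]) (auto simp: normal_density_nonneg)
  then show "expectation (\<lambda>\<omega>. Y \<omega> ^ (2 * k)) = fact (2 * k) / (2 ^ k * fact k) * (\<sigma>\<^sup>2) ^ k"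
    using integral_normal_moment_even[OF \<sigma>, of 0 k] \<sigma> by (simp add: power_divide)
qed

text \<open>The density is at most \<open>1 / \<sigma>\<close> because
  \<open>2 * pi \<ge> 1\<close>, and the interval has length \<open>2 * \<epsilon>\<close>.\<close>

lemma normal_small_ball:
  assumes D: "distributed M lborel Y (\<lambda>x. ennreal (normal_density 0 \<sigma> x))" and \<sigma>: "0 < \<sigma>" and \<epsilon>: "0 \<le> \<epsilon>"
  shows "prob {\<omega> \<in> space M. \<bar>Y \<omega>\<bar> < \<epsilon>} \<le> 2 * \<epsilon> / \<sigma>"
proof -
  have dens: "normal_density 0 \<sigma> x \<le> 1 / \<sigma>" for x
  proof -
    have "\<sigma>\<^sup>2 \<le> 2 * pi * \<sigma>\<^sup>2" using pi_ge_two by (simp add: mult_le_cancel_right1)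
    then have "\<sigma> \<le> sqrt (2 * pi * \<sigma>\<^sup>2)" using \<sigma> by (intro real_le_rsqrt)
    then have "1 / sqrt (2 * pi * \<sigma>\<^sup>2) \<le> 1 / \<sigma>" using \<sigma> by (intro divide_left_mono) auto
    moreover have "exp (- (x - 0)\<^sup>2 / (2 * \<sigma>\<^sup>2)) \<le> 1" by simp
    ultimately have "1 / sqrt (2 * pi * \<sigma>\<^sup>2) * exp (- (x - 0)\<^sup>2 / (2 * \<sigma>\<^sup>2)) \<le> 1 / \<sigma> * 1"
      using \<sigma> by (intro mult_mono) auto
    then show ?thesis by (simp add: normal_density_def)
  qed
  have "{\<omega> \<in> space M. \<bar>Y \<omega>\<bar> < \<epsilon>} = Y -` {- \<epsilon><..<\<epsilon>} \<inter> space M" by auto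
  then have "emeasure M {\<omega> \<in> space M. \<bar>Y \<omega>\<bar> < \<epsilon>} =
      (\<integral>\<^sup>+x. ennreal (normal_density 0 \<sigma> x) * indicator {- \<epsilon><..<\<epsilon>} x \<partial>lborel)"
    using distributed_emeasure[OF D, of "{- \<epsilon><..<\<epsilon>}"] by simp
  also have "\<dots> \<le> (\<integral>\<^sup>+x. ennreal (1 / \<sigma>) * indicator {- \<epsilon><..<\<epsilon>} x \<partial>lborel)"
    using dens by (intro nn_integral_mono mult_right_mono ennreal_leI) auto
  also have "\<dots> = ennreal (1 / \<sigma>) * ennreal (2 * \<epsilon>)"
    using \<epsilon> by (simp add: nn_integral_cmult_indicator)
  also have "\<dots> = ennreal (2 * \<epsilon> / \<sigma>)"
    using \<epsilon> \<sigma> by (simp flip: ennreal_mult)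
  finally show ?thesis
    using \<epsilon> \<sigma> by (simp add: emeasure_eq_measure)
qed

section \<open>Path regularity and threshold crossings for \<open>class_X\<close>\<close>

lemma class_X_cont: "class_X M H \<beta> X \<Longrightarrow> \<omega> \<in> space M \<Longrightarrow> continuous_on {0..1} (\<lambda>t. X t \<omega>)"
  by (simp add: class_X_def)

lemma gaussian_process_increment:
  assumes "gaussian_process M X" "s \<in> {0..1}" "t \<in> {0..1}" "s \<noteq> t"
  shows "gaussian_rv M (\<lambda>\<omega>. X t \<omega> - X s \<omega>)"
proof -
  have "gaussian_rv M (\<lambda>\<omega>. \<Sum>u\<in>{s, t}. (if u = t then 1 else - 1) * X u \<omega>)"
    using assms(1)[unfolded gaussian_process_def, rule_format, of "{s, t}" "\<lambda>u. if u = t then 1 else - 1"] assms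
    by simp
  then show ?thesis using assms(4) by simp
qed

lemma gaussian_process_marginal:
  assumes "gaussian_process M X" "t \<in> {0..1}"
  shows "gaussian_rv M (X t)"
  using assms(1)[unfolded gaussian_process_def, rule_format, of "{t}" "\<lambda>_. 1"] assms by simp

lemma class_X_increment_distributed:
  assumes X: "class_X M H \<beta> X" and st: "s \<in> {0..1}" "t \<in> {0..1}" "s \<noteq> t" and v: "0 < incr_var M X s t"
  shows "distributed M lborel (\<lambda>\<omega>. X t \<omega> - X s \<omega>) (\<lambda>x. ennreal (normal_density 0 (sqrt (incr_var M X s t)) x))"
proof -
  have G: "gaussian_process M X" and mean: "\<And>u. u \<in> {0..1} \<Longrightarrow> expectation (X u) = 0"
    using X by (auto simp: class_X_def)
  have "expectation (\<lambda>\<omega>. X t \<omega> - X s \<omega>) = expectation (X t) - expectation (X s)"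
    using st by (intro Bochner_Integration.integral_diff gaussian_rv_integrable gaussian_process_marginal[OF G])
  then have "expectation (\<lambda>\<omega>. X t \<omega> - X s \<omega>) = 0" using mean st by simp
  then show ?thesis
    using gaussian_rv_centered[OF gaussian_process_increment[OF G st]] v by (simp add: incr_var_def)
qed

text \<open>The moment of order \<open>2 * k\<close> of a centered Gaussian increment is a constant
  times the \<open>k\<close>-th power of its variance. So \<open>hoelder_paths_of_moments\<close>
  yields all orders below \<open>H - 1 / (2 * k)\<close>, and \<open>k\<close> is taken
  large.\<close>

lemma class_X_hoelder_paths:
  assumes X: "class_X M H \<beta> X" and h: "0 < h" "h < H"
  shows "AE \<omega> in M. \<exists>K\<ge>0. \<forall>s\<in>{0..1}. \<forall>t\<in>{0..1}. \<bar>X t \<omega> - X s \<omega>\<bar> \<le> K * \<bar>t - s\<bar> powr h"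
proof -
  obtain c C where c: "0 < c" "0 < C"
    and var: "\<And>s t. s \<in> {0..1} \<Longrightarrow> t \<in> {0..1} \<Longrightarrow> c * \<bar>t - s\<bar> powr (2 * \<beta>) \<le> incr_var M X s t"
      "\<And>s t. s \<in> {0..1} \<Longrightarrow> t \<in> {0..1} \<Longrightarrow> incr_var M X s t \<le> C * \<bar>t - s\<bar> powr (2 * H)"
    using X unfolding class_X_def by blast
  obtain k :: nat where "1 / (2 * (H - h)) < real k" using reals_Archimedean2 by blast
  then have k: "1 < 2 * (H - h) * real k" using h by (simp add: field_simps)
  then have k0: "0 < k" by (cases k) auto
  define A where "A = fact (2 * k) / (2 ^ k * fact k) * C ^ k"
  have moment: "integrable M (\<lambda>\<omega>. (X t \<omega> - X s \<omega>) ^ (2 * k)) \<and>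
     expectation (\<lambda>\<omega>. (X t \<omega> - X s \<omega>) ^ (2 * k)) \<le> A * \<bar>t - s\<bar> powr (1 + (2 * H * real k - 1))"
    if st: "s \<in> {0..1}" "t \<in> {0..1}" for s t
  proof (cases "s = t")
    case True
    then show ?thesis using k0 by (simp add: power_0_left)
  next
    case False
    have "0 < c * \<bar>t - s\<bar> powr (2 * \<beta>)" using False c by simp
    then have v: "0 < incr_var M X s t" using var(1)[OF st] by linarith
    note D = class_X_increment_distributed[OF X st False v]
    have "expectation (\<lambda>\<omega>. (X t \<omega> - X s \<omega>) ^ (2 * k)) = fact (2 * k) / (2 ^ k * fact k) * incr_var M X s t ^ k"
      using normal_even_moment(2)[OF D, of k] v by simp
    also have "\<dots> \<le> fact (2 * k) / (2 ^ k * fact k) * (C * \<bar>t - s\<bar> powr (2 * H)) ^ k"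
      using v var(2)[OF st] by (intro mult_left_mono power_mono) auto
    also have "\<dots> = A * \<bar>t - s\<bar> powr (1 + (2 * H * real k - 1))"
      using False by (simp add: A_def power_mult_distrib powr_powr flip: powr_realpow)
    finally show ?thesis using normal_even_moment(1)[OF D, of k] v by simp
  qed
  show ?thesis
  proof (rule hoelder_paths_of_moments[where m = "2 * k" and c = A and b = "2 * H * real k - 1"])
    show "X t \<in> borel_measurable M" if "t \<in> {0..1}" for t
      using gaussian_process_marginal[of X t] X that by (auto simp: class_X_def gaussian_rv_def)
    show "h * real (2 * k) < 2 * H * real k - 1" using k by (simp add: algebra_simps)
    show "0 \<le> A" using c by (simp add: A_def)
  qed (use class_X_cont[OF X] h moment in auto)
qed

text \<open>By \<open>normal_small_ball\<close> the chance of a miss on stage \<open>n\<close> is at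
  most of order \<open>2 ^ (- n * (\<kappa> - \<beta>))\<close>, and Borel-Cantelli applies.\<close>

lemma class_X_threshold_hits:
  assumes X: "class_X M H \<beta> X" and \<kappa>: "\<beta> < \<kappa>"
  shows "AE \<omega> in M. \<forall>\<^sub>F n in sequentially. threshold \<kappa> n \<le> \<bar>X (grid (Suc n)) \<omega> - X (grid n) \<omega>\<bar>"
proof -
  obtain c where c: "0 < c"
    and var: "\<And>s t. s \<in> {0..1} \<Longrightarrow> t \<in> {0..1} \<Longrightarrow> c * \<bar>t - s\<bar> powr (2 * \<beta>) \<le> incr_var M X s t"
    using X unfolding class_X_def by blast
  have grid01: "grid n \<in> {0..1}" for n using grid_nonneg[of n] grid_less_1[of n] by auto
  have meas: "X (grid n) \<in> borel_measurable M" for n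
    using gaussian_process_marginal[of X "grid n"] X grid01[of n] by (auto simp: class_X_def gaussian_rv_def)
  define A where "A = (\<lambda>n. {\<omega> \<in> space M. \<bar>X (grid (Suc n)) \<omega> - X (grid n) \<omega>\<bar> < threshold \<kappa> n})"
  have Am: "A n \<in> sets M" for n
    unfolding A_def using meas[of n] meas[of "Suc n"] by measurable
  \<comment> \<open>The \<open>2\<close> stems from the small ball estimate,
    \<open>2 powr \<beta>\<close> from the stage length \<open>d / 2\<close>, and
    \<open>sqrt c\<close> from the lower variance bound.\<close>
  define B where "B = 2 * 2 powr \<beta> / sqrt c"
  have PA: "prob (A n) \<le> B * ((1 / 2) powr (\<kappa> - \<beta>)) ^ n" for n
  proof -
    define d where "d = (1 / 2 :: real) ^ n"
    have d: "0 < d" by (simp add: d_def)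
    let ?v = "incr_var M X (grid n) (grid (Suc n))"
    have ne: "grid n \<noteq> grid (Suc n)" using grid_less_Suc[of n] by simp
    have lower: "c * (d / 2) powr (2 * \<beta>) \<le> ?v"
      using var[OF grid01[of n] grid01[of "Suc n"]] by (simp add: grid_Suc_diff d_def)
    moreover have "0 < c * (d / 2) powr (2 * \<beta>)" using c d by simp
    ultimately have v: "0 < ?v" by linarith
    have "(d / 2) powr (2 * \<beta>) = ((d / 2) powr \<beta>)\<^sup>2"
      using powr_add[of "d / 2" \<beta> \<beta>] by (simp add: power2_eq_square)
    then have "sqrt (c * (d / 2) powr (2 * \<beta>)) = sqrt c * (d / 2) powr \<beta>"
      by (simp add: real_sqrt_mult)
    then have sd: "sqrt c * (d / 2) powr \<beta> \<le> sqrt ?v"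
      using lower real_sqrt_le_mono by metis
    have "prob (A n) \<le> 2 * threshold \<kappa> n / sqrt ?v"
      unfolding A_def
      by (rule normal_small_ball[OF class_X_increment_distributed[OF X grid01 grid01 ne v]])
        (use v less_imp_le[OF threshold_pos] in auto)
    also have "\<dots> \<le> 2 * threshold \<kappa> n / (sqrt c * (d / 2) powr \<beta>)"
      using sd c d less_imp_le[OF threshold_pos[of \<kappa> n]] v by (intro divide_left_mono) auto
    also have "\<dots> = B * d powr (\<kappa> - \<beta>)"
      using d c by (simp add: threshold_def B_def powr_diff powr_divide flip: d_def)
    also have "d powr (\<kappa> - \<beta>) = ((1 / 2) powr (\<kappa> - \<beta>)) ^ n"
      by (simp add: d_def powr_powr powr_realpow[symmetric] mult.commute)
    finally show ?thesis .
  qed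
  have "(1 / 2) powr (\<kappa> - \<beta>) < (1 / 2 :: real) powr 0"
    by (rule powr_less_mono') (use \<kappa> in auto)
  then have "summable (\<lambda>n. B * ((1 / 2) powr (\<kappa> - \<beta>)) ^ n)"
    by (intro summable_mult summable_geometric) auto
  then have "summable (\<lambda>n. prob (A n))"
    by (rule summable_comparison_test_ev[rotated]) (use PA in auto)
  then have "AE \<omega> in M. \<forall>\<^sub>F n in sequentially. \<omega> \<in> space M - A n"
    by (intro borel_cantelli_AE1 Am) (auto simp: emeasure_eq_measure)
  then show ?thesis
    by eventually_elim (auto simp: A_def elim!: eventually_mono)
qed

end

section \<open>Choice of the exponents and conclusion path by path\<close>

theorem theorem4p1:
  fixes M :: "'a measure"
    and X z :: "real \<Rightarrow> 'a \<Rightarrow> real"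
    and \<xi> :: "'a \<Rightarrow> real"
    and H \<beta> \<theta> :: real
  assumes "prob_space M" and "complete_measure M"
    and "1 / 2 < H" and "H < 1" and "H \<le> \<beta>" and "\<beta> < 1"
    and "\<beta> < 3 * H / (H + 2)"
    and "class_X M H \<beta> X"
    and "\<xi> \<in> borel_measurable (natural_filtration M X 1)"
    and "adapted_process (natural_filtration M X) z"
    and "\<theta> > (2 - 2 * H) / (1 - \<beta>) * \<beta> - 2 * H"
    and "AE \<omega> in M. hoelder_on {0..1} \<theta> (\<lambda>t. z t \<omega>)"
    and "AE \<omega> in M. z 1 \<omega> = \<xi> \<omega>"
  shows "\<exists>\<psi>. adapted_process (natural_filtration M X) \<psi> \<and>
           (AE \<omega> in M. continuous_on {0..<1} (\<lambda>t. \<psi> t \<omega>)) \<and>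
           (AE \<omega> in M. has_rs_integral (\<lambda>t. \<psi> t \<omega>) (\<lambda>t. X t \<omega>) 0 1 (\<xi> \<omega>))"
proof -
  interpret prob_space M by fact
  \<comment> \<open>Since \<open>H \<le> \<beta>\<close>, the condition on \<open>\<theta>\<close>
    implies \<open>\<theta> > 2 * \<beta> - 2 * H\<close>, the form used below.\<close>
  have "2 \<le> (2 - 2 * H) / (1 - \<beta>)" using \<open>H \<le> \<beta>\<close> \<open>\<beta> < 1\<close> by (simp add: le_divide_eq)
  then have "2 * \<beta> \<le> (2 - 2 * H) / (1 - \<beta>) * \<beta>"
    using \<open>1 / 2 < H\<close> \<open>H \<le> \<beta>\<close> by (intro mult_right_mono) auto
  then have slack: "0 < \<theta> - 2 * \<beta> + 2 * H" using assms(11) by linarith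
  \<comment> \<open>The slack \<open>s\<close> is shared between the exponents:
    \<open>h > H - s / 4\<close> and \<open>\<kappa> = \<beta> + s / 8\<close> give
    \<open>2 * \<kappa> - \<theta> = 2 * H - 3 * s / 4 < 2 * h\<close>.\<close>
  define s where "s = \<theta> - 2 * \<beta> + 2 * H"
  obtain h where h: "max (1 / 2) (H - s / 4) < h" "h < H"
    using dense[of "max (1 / 2) (H - s / 4)" H] slack \<open>1 / 2 < H\<close> by (auto simp: s_def)
  define \<kappa> where "\<kappa> = \<beta> + s / 8"
  have par: "1 / 2 < h" "h \<le> \<kappa>" "0 < \<theta>" "2 * \<kappa> - \<theta> < 2 * h" "\<beta> < \<kappa>"
  proof -
    have "0 < s" "\<theta> = s + 2 * \<beta> - 2 * H" using slack by (auto simp: s_def)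
    moreover have "1 / 2 < h" "H - s / 4 < h" using h by auto
    moreover have "\<kappa> = \<beta> + s / 8" by (rule \<kappa>_def)
    ultimately show "1 / 2 < h" "h \<le> \<kappa>" "0 < \<theta>" "2 * \<kappa> - \<theta> < 2 * h" "\<beta> < \<kappa>"
      using h(2) \<open>H \<le> \<beta>\<close> by argo+
  qed
  have h0: "0 < h" using par by simp
  define \<psi> where "\<psi> = (\<lambda>t \<omega>. integrand \<kappa> (\<lambda>s. X s \<omega>) (\<lambda>s. z s \<omega>) t)"
  have cont: "continuous_on {0..1} (\<lambda>t. X t \<omega>)" if "\<omega> \<in> space M" for \<omega>
    by (rule class_X_cont[OF assms(8) that])
  have "AE \<omega> in M. continuous_on {0..<1} (\<lambda>t. \<psi> t \<omega>) \<and>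
      has_rs_integral (\<lambda>t. \<psi> t \<omega>) (\<lambda>t. X t \<omega>) 0 1 (\<xi> \<omega>)"
    using class_X_hoelder_paths[OF assms(8) h0 h(2)] class_X_threshold_hits[OF assms(8) par(5)]
      assms(12,13) AE_space
  proof eventually_elim
    case (elim \<omega>)
    obtain K where K: "0 \<le> K"
      "\<And>s t. s \<in> {0..1} \<Longrightarrow> t \<in> {0..1} \<Longrightarrow> \<bar>X t \<omega> - X s \<omega>\<bar> \<le> K * \<bar>t - s\<bar> powr h"
      using elim(1) by blast
    obtain L where L: "\<And>s t. s \<in> {0..1} \<Longrightarrow> t \<in> {0..1} \<Longrightarrow> \<bar>z t \<omega> - z s \<omega>\<bar> \<le> L * \<bar>t - s\<bar> powr \<theta>"
      using elim(3) unfolding hoelder_on_def by blast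
    \<comment> \<open>\<open>hoelder_on\<close> puts no sign condition on its constant, so the
      modulus is taken.\<close>
    have z: "\<bar>z t \<omega> - z s \<omega>\<bar> \<le> \<bar>L\<bar> * \<bar>t - s\<bar> powr \<theta>" if "s \<in> {0..1}" "t \<in> {0..1}" for s t
      using L[OF that] by (rule order_trans) (intro mult_right_mono, auto)
    note paths = par(1-4) K(1) abs_ge_zero[of L] cont[OF elim(5)] K(2) z
    show ?case
      using integrand_continuous[OF paths] integrand_has_rs_integral[OF paths elim(2)] elim(4)
      by (simp add: \<psi>_def)
  qed
  moreover have "adapted_process (natural_filtration M X) \<psi>"
    unfolding \<psi>_def using cont assms(10) by (rule integrand_adapted)
  ultimately show ?thesis by (auto simp: AE_conj_iff)
qed

end
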